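(* Let $\lambda=(\lambda_1^{m_1},\ldots,\lambda_r^{m_r})$ be a partition, where $0<\lambda_1<\cdots<\lambda_r$ are integers and $m_1,\ldots,m_r$ are positive integers. (1) There are exactly $r$ isomorphism classes of simple $M_\lambda(E)$-modules, represented by $D_1,\ldots,D_r$, where $D_j$ is, as an $E$-vector space, $E^{m_j}$, and $a=(a_{ij})\in M_\lambda(E)$ acts on $D_j$ by the image of $a_{jj}$ under reduction modulo $t$ in the ring $M_{1^{m_j}}(E)$ of $m_j\times m_j$ matrices over $E$. (2) For $i=1,\ldots,r$ let $P_i=M_\lambda(E)e_{i1}$. Then $P_1,\ldots,P_r$ is a complete set of representatives for the isomorphism classes of principal indecomposable $M_\lambda(E)$-modules.
   Context: $K$ is a perfect field, $p(t)\in K[t]$ is irreducible, and $E=K[t]/p(t)$. The notation $\lambda=(\lambda_1^{m_1},\ldots,\lambda_r^{m_r})$ means the part $\lambda_i$ occurs $m_i$ times. Put $E_{\lambda_j}^{m_j}=E[t]/(t^{\lambda_j})^{\oplus m_j}$, $E_\lambda=E_{\lambda_1}^{m_1}\oplus\cdots\oplus E_{\lambda_r}^{m_r}$ (an $E[t]$-module), and $M_\lambda(E)=\mathrm{End}_{E[t]}(E_\lambda)$. An element $a\in M_\lambda(E)$ is written as a block matrix $a=(a_{ij})_{1\le i,j\le r}$ with $a_{ij}\in\mathrm{Hom}_{E[t]}(E_{\lambda_j}^{m_j},E_{\lambda_i}^{m_i})$. Reduction modulo $t$ is the induced ring homomorphism $\mathrm{End}_{E[t]}(E_{\lambda_j}^{m_j})\to\mathrm{End}_E(E^{m_j})=M_{1^{m_j}}(E)$.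 For $1\le i\le r$ and $1\le j\le m_i$, $e_{ij}\in M_\lambda(E)$ is the element whose block matrix has all entries zero except the $(i,i)$th entry, which, as an $m_i\times m_i$ matrix over $E[t]/(t^{\lambda_i})$, has all entries zero except the $(j,j)$th entry, which equals $1$. Modules are left modules. The principal indecomposable modules of a finite dimensional algebra $A$ are the indecomposable direct summands of $A$ as a left module over itself. *)

theory Defs
  imports "HOL-Algebra.Algebra" "HOL-Computational_Algebra.Primes"
begin

section \<open>Perfect fields\<close>

definition perfect_field :: "('k, 'x) ring_scheme \<Rightarrow> bool" where
  "perfect_field K \<longleftrightarrow> field K \<and>
     (\<forall>q::nat. Factorial_Ring.prime q \<longrightarrow> [q] \<cdot>\<^bsub>K\<^esub> \<one>\<^bsub>K\<^esub> = \<zero>\<^bsub>K\<^esub> \<longrightarrow>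
        (\<forall>x\<in>carrier K. \<exists>y\<in>carrier K. y [^]\<^bsub>K\<^esub> q = x))"


section \<open>Left modules over a ring that need not be commutative\<close>

text \<open>The locale \<^locale>\<open>module\<close> is restricted to commutative rings; the record type for modules
  and the locale \<^locale>\<open>submodule\<close> are not, and are reused here.
  The ring multiplication and unit that this record type provides are not used for modules.\<close>

locale left_module = R?: ring R + M?: abelian_group M
  for R :: "('a, 'x) ring_scheme" (structure) and M :: "('a, 'b, 'y) module_scheme" (structure) +
  assumes smult_closed:
      "\<lbrakk>a \<in> carrier R; x \<in> carrier M\<rbrakk> \<Longrightarrow> a \<odot>\<^bsub>M\<^esub> x \<in> carrier M"
    and smult_l_distr:
      "\<lbrakk>a \<in> carrier R; b \<in> carrier R; x \<in> carrier M\<rbrakk> \<Longrightarrow>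
        (a \<oplus>\<^bsub>R\<^esub> b) \<odot>\<^bsub>M\<^esub> x = a \<odot>\<^bsub>M\<^esub> x \<oplus>\<^bsub>M\<^esub> b \<odot>\<^bsub>M\<^esub> x"
    and smult_r_distr:
      "\<lbrakk>a \<in> carrier R; x \<in> carrier M; y \<in> carrier M\<rbrakk> \<Longrightarrow>
        a \<odot>\<^bsub>M\<^esub> (x \<oplus>\<^bsub>M\<^esub> y) = a \<odot>\<^bsub>M\<^esub> x \<oplus>\<^bsub>M\<^esub> a \<odot>\<^bsub>M\<^esub> y"
    and smult_assoc:
      "\<lbrakk>a \<in> carrier R; b \<in> carrier R; x \<in> carrier M\<rbrakk> \<Longrightarrow>
        (a \<otimes>\<^bsub>R\<^esub> b) \<odot>\<^bsub>M\<^esub> x = a \<odot>\<^bsub>M\<^esub> (b \<odot>\<^bsub>M\<^esub> x)"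
    and smult_one:
      "x \<in> carrier M \<Longrightarrow> \<one>\<^bsub>R\<^esub> \<odot>\<^bsub>M\<^esub> x = x"

definition mod_homs ::
    "('a, 'x) ring_scheme \<Rightarrow> ('a, 'b) module \<Rightarrow> ('a, 'c) module \<Rightarrow> ('b \<Rightarrow> 'c) set" where
  "mod_homs R M N = {f \<in> carrier M \<rightarrow>\<^sub>E carrier N.
     (\<forall>x\<in>carrier M. \<forall>y\<in>carrier M. f (x \<oplus>\<^bsub>M\<^esub> y) = f x \<oplus>\<^bsub>N\<^esub> f y) \<and>
     (\<forall>a\<in>carrier R. \<forall>x\<in>carrier M. f (a \<odot>\<^bsub>M\<^esub> x) = a \<odot>\<^bsub>N\<^esub> f x)}"

definition mod_iso ::
    "('a, 'x) ring_scheme \<Rightarrow> ('a, 'b) module \<Rightarrow> ('a, 'c) module \<Rightarrow> bool" where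
  "mod_iso R M N \<longleftrightarrow> (\<exists>f\<in>mod_homs R M N. bij_betw f (carrier M) (carrier N))"

definition simple_module :: "('a, 'x) ring_scheme \<Rightarrow> ('a, 'b) module \<Rightarrow> bool" where
  "simple_module R M \<longleftrightarrow> left_module R M \<and> carrier M \<noteq> {\<zero>\<^bsub>M\<^esub>} \<and>
     (\<forall>N. submodule N R M \<longrightarrow> N = {\<zero>\<^bsub>M\<^esub>} \<or> N = carrier M)"

definition internal_direct_sum ::
    "('a, 'x) ring_scheme \<Rightarrow> ('a, 'b) module \<Rightarrow> 'b set \<Rightarrow> 'b set \<Rightarrow> bool" where
  "internal_direct_sum R M N N' \<longleftrightarrow> submodule N R M \<and> submodule N' R M \<and>
     N <+>\<^bsub>M\<^esub> N' = carrier M \<and> N \<inter> N' = {\<zero>\<^bsub>M\<^esub>}"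

definition indecomposable_module :: "('a, 'x) ring_scheme \<Rightarrow> ('a, 'b) module \<Rightarrow> bool" where
  "indecomposable_module R M \<longleftrightarrow> left_module R M \<and> carrier M \<noteq> {\<zero>\<^bsub>M\<^esub>} \<and>
     (\<forall>N N'. internal_direct_sum R M N N' \<longrightarrow> N = {\<zero>\<^bsub>M\<^esub>} \<or> N' = {\<zero>\<^bsub>M\<^esub>})"

definition regular_module :: "('a, 'x) ring_scheme \<Rightarrow> ('a, 'a) module" where
  "regular_module R = \<lparr>carrier = carrier R, monoid.mult = monoid.mult R, monoid.one = \<one>\<^bsub>R\<^esub>,
     ring.zero = \<zero>\<^bsub>R\<^esub>, ring.add = ring.add R, module.smult = monoid.mult R\<rparr>"

definition regular_submodule :: "('a, 'x) ring_scheme \<Rightarrow> 'a set \<Rightarrow> ('a, 'a) module" where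
  "regular_submodule R P = (regular_module R)\<lparr>carrier := P\<rparr>"

definition principal_indecomposable :: "('a, 'x) ring_scheme \<Rightarrow> 'a set \<Rightarrow> bool" where
  "principal_indecomposable R P \<longleftrightarrow>
     (\<exists>Q. internal_direct_sum R (regular_module R) P Q) \<and>
     indecomposable_module R (regular_submodule R P)"

definition quotient_module :: "('a, 'x) ring_scheme \<Rightarrow> 'a set \<Rightarrow> ('a, 'a set) module" where
  "quotient_module R I = \<lparr>carrier = carrier (R Quot I), monoid.mult = monoid.mult (R Quot I),
     monoid.one = \<one>\<^bsub>R Quot I\<^esub>, ring.zero = \<zero>\<^bsub>R Quot I\<^esub>, ring.add = ring.add (R Quot I),
     module.smult = (\<lambda>a x. (I +>\<^bsub>R\<^esub> a) \<otimes>\<^bsub>R Quot I\<^esub> x)\<rparr>"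

text \<open>Only used for finite index sets, where the product is the direct sum.\<close>

definition direct_sum :: "'i set \<Rightarrow> ('i \<Rightarrow> ('a, 'b) module) \<Rightarrow> ('a, 'i \<Rightarrow> 'b) module" where
  "direct_sum I N = \<lparr>carrier = (\<Pi>\<^sub>E i\<in>I. carrier (N i)), monoid.mult = undefined, monoid.one = undefined,
     ring.zero = (\<lambda>i\<in>I. \<zero>\<^bsub>N i\<^esub>), ring.add = (\<lambda>x y. \<lambda>i\<in>I. x i \<oplus>\<^bsub>N i\<^esub> y i),
     module.smult = (\<lambda>a x. \<lambda>i\<in>I. a \<odot>\<^bsub>N i\<^esub> x i)\<rparr>"

definition summand_incl :: "'i set \<Rightarrow> ('i \<Rightarrow> ('a, 'b) module) \<Rightarrow> 'i \<Rightarrow> 'b \<Rightarrow> ('i \<Rightarrow> 'b)" where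
  "summand_incl I N j x = (\<lambda>i\<in>I. if i = j then x else \<zero>\<^bsub>N i\<^esub>)"

definition block_entry ::
    "'i set \<Rightarrow> ('i \<Rightarrow> ('a, 'b) module) \<Rightarrow> (('i \<Rightarrow> 'b) \<Rightarrow> ('i \<Rightarrow> 'b)) \<Rightarrow> 'i \<Rightarrow> 'i \<Rightarrow> 'b \<Rightarrow> 'b" where
  "block_entry I N a i j = (\<lambda>x\<in>carrier (N j). a (summand_incl I N j x) i)"

definition endo_ring :: "('a, 'x) ring_scheme \<Rightarrow> ('a, 'b) module \<Rightarrow> ('b \<Rightarrow> 'b) ring" where
  "endo_ring R M = \<lparr>carrier = mod_homs R M M,
     monoid.mult = (\<lambda>f g. compose (carrier M) f g), monoid.one = (\<lambda>x\<in>carrier M. x),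
     ring.zero = (\<lambda>x\<in>carrier M. \<zero>\<^bsub>M\<^esub>), ring.add = (\<lambda>f g. \<lambda>x\<in>carrier M. f x \<oplus>\<^bsub>M\<^esub> g x)\<rparr>"


section \<open>The module \<open>E\<^sub>\<lambda>\<close> and its endomorphism algebra\<close>

definition trunc_poly :: "('e, 'x) ring_scheme \<Rightarrow> nat \<Rightarrow> ('e list, 'e list set) module" where
  "trunc_poly E n = quotient_module (poly_ring E)
     (PIdl\<^bsub>poly_ring E\<^esub> (X\<^bsub>E\<^esub> [^]\<^bsub>poly_ring E\<^esub> n))"

definition isotypic_block ::
    "('e, 'x) ring_scheme \<Rightarrow> nat \<Rightarrow> nat \<Rightarrow> ('e list, nat \<Rightarrow> 'e list set) module" where
  "isotypic_block E n k = direct_sum {1..k} (\<lambda>_. trunc_poly E n)"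

definition E_lam :: "('e, 'x) ring_scheme \<Rightarrow> nat \<Rightarrow> (nat \<Rightarrow> nat) \<Rightarrow> (nat \<Rightarrow> nat) \<Rightarrow>
    ('e list, nat \<Rightarrow> nat \<Rightarrow> 'e list set) module" where
  "E_lam E r lam m = direct_sum {1..r} (\<lambda>i. isotypic_block E (lam i) (m i))"

definition M_lam :: "('e, 'x) ring_scheme \<Rightarrow> nat \<Rightarrow> (nat \<Rightarrow> nat) \<Rightarrow> (nat \<Rightarrow> nat) \<Rightarrow>
    ((nat \<Rightarrow> nat \<Rightarrow> 'e list set) \<Rightarrow> (nat \<Rightarrow> nat \<Rightarrow> 'e list set)) ring" where
  "M_lam E r lam m = endo_ring (poly_ring E) (E_lam E r lam m)"

definition coord_space :: "('e, 'x) ring_scheme \<Rightarrow> nat \<Rightarrow> ('e, nat \<Rightarrow> 'e) module" where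
  "coord_space E k = direct_sum {1..k} (\<lambda>_. regular_module E)"

text \<open>Reduction modulo \<open>t\<close>. For \<open>n > 0\<close> all polynomials in a class modulo \<open>t\<^sup>n\<close> have the same
  constant term, which gives the map from \<open>E[t]/(t\<^sup>n)\<close> to \<open>E[t]/(t) = E\<close>. An endomorphism of
  \<open>(E[t]/(t\<^sup>n))\<^sup>k\<close> is compatible with the componentwise map to \<open>E\<^sup>k\<close>, and \<open>reduce_endo\<close> is the
  endomorphism of \<open>E\<^sup>k\<close> that it induces: the value at \<open>w\<close> is the common reduction of all the
  images of the vectors reducing to \<open>w\<close>.\<close>

definition reduce :: "('e, 'x) ring_scheme \<Rightarrow> 'e list set \<Rightarrow> 'e" where
  "reduce E x = the_elem (ring.const_term E ` x)"

definition reduce_vec ::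
    "('e, 'x) ring_scheme \<Rightarrow> nat \<Rightarrow> (nat \<Rightarrow> 'e list set) \<Rightarrow> (nat \<Rightarrow> 'e)" where
  "reduce_vec E k v = (\<lambda>l\<in>{1..k}. reduce E (v l))"

definition reduce_endo :: "('e, 'x) ring_scheme \<Rightarrow> nat \<Rightarrow> nat \<Rightarrow>
    ((nat \<Rightarrow> 'e list set) \<Rightarrow> (nat \<Rightarrow> 'e list set)) \<Rightarrow> (nat \<Rightarrow> 'e) \<Rightarrow> (nat \<Rightarrow> 'e)" where
  "reduce_endo E n k f = (\<lambda>w\<in>carrier (coord_space E k).
     the_elem (reduce_vec E k ` f ` {v \<in> carrier (isotypic_block E n k). reduce_vec E k v = w}))"

definition D_module :: "('e, 'x) ring_scheme \<Rightarrow> nat \<Rightarrow> (nat \<Rightarrow> nat) \<Rightarrow> (nat \<Rightarrow> nat) \<Rightarrow> nat \<Rightarrow>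
    ((nat \<Rightarrow> nat \<Rightarrow> 'e list set) \<Rightarrow> (nat \<Rightarrow> nat \<Rightarrow> 'e list set), nat \<Rightarrow> 'e) module" where
  "D_module E r lam m j = \<lparr>carrier = carrier (coord_space E (m j)), monoid.mult = undefined,
     monoid.one = undefined, ring.zero = \<zero>\<^bsub>coord_space E (m j)\<^esub>, ring.add = ring.add (coord_space E (m j)),
     module.smult = (\<lambda>a. reduce_endo E (lam j) (m j)
       (block_entry {1..r} (\<lambda>i. isotypic_block E (lam i) (m i)) a j j))\<rparr>"

text \<open>The image of \<open>c \<in> E\<close> in the \<open>E\<close>-algebra \<open>M\<^sub>\<lambda>(E)\<close>. It makes every module over that
  algebra an \<open>E\<close>-vector space.\<close>

definition scalar_endo :: "('e, 'x) ring_scheme \<Rightarrow> nat \<Rightarrow> (nat \<Rightarrow> nat) \<Rightarrow> (nat \<Rightarrow> nat) \<Rightarrow> 'e \<Rightarrow>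
    (nat \<Rightarrow> nat \<Rightarrow> 'e list set) \<Rightarrow> (nat \<Rightarrow> nat \<Rightarrow> 'e list set)" where
  "scalar_endo E r lam m c =
     (\<lambda>v\<in>carrier (E_lam E r lam m). ring.poly_of_const E c \<odot>\<^bsub>E_lam E r lam m\<^esub> v)"

text \<open>The endomorphism whose only nonzero block is the \<open>(i,i)\<close>th one, which in turn is the
  matrix unit at \<open>(j,j)\<close>: it projects onto the \<open>j\<close>th copy of \<open>E[t]/(t\<^bsup>\<lambda>\<^sub>i\<^esup>)\<close>.\<close>

definition e_elem :: "('e, 'x) ring_scheme \<Rightarrow> nat \<Rightarrow> (nat \<Rightarrow> nat) \<Rightarrow> (nat \<Rightarrow> nat) \<Rightarrow> nat \<Rightarrow> nat \<Rightarrow>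
    (nat \<Rightarrow> nat \<Rightarrow> 'e list set) \<Rightarrow> (nat \<Rightarrow> nat \<Rightarrow> 'e list set)" where
  "e_elem E r lam m i j = (\<lambda>v\<in>carrier (E_lam E r lam m).
     summand_incl {1..r} (\<lambda>i. isotypic_block E (lam i) (m i)) i
       (summand_incl {1..m i} (\<lambda>_. trunc_poly E (lam i)) j (v i j)))"

definition P_ideal :: "('e, 'x) ring_scheme \<Rightarrow> nat \<Rightarrow> (nat \<Rightarrow> nat) \<Rightarrow> (nat \<Rightarrow> nat) \<Rightarrow> nat \<Rightarrow>
    ((nat \<Rightarrow> nat \<Rightarrow> 'e list set) \<Rightarrow> (nat \<Rightarrow> nat \<Rightarrow> 'e list set)) set" where
  "P_ideal E r lam m i =
     {a \<otimes>\<^bsub>M_lam E r lam m\<^esub> e_elem E r lam m i 1 | a. a \<in> carrier (M_lam E r lam m)}"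

end

theory Submission
  imports Defs
begin

text \<open>Write \<open>e\<^sub>i\<^sub>k\<close> for the diagonal matrix units and \<open>e\<^sub>i = e\<^sub>i\<^sub>1\<close>. Each \<open>e\<^sub>i\<^sub>k\<close> is
  local: its corner ring is \<open>End(E[t]/(t\<^bsup>\<lambda>\<^sub>i\<^esup>))\<close>, where an endomorphism is invertible as soon as it is
  nonzero modulo \<open>t\<close>. The \<open>e\<^sub>i\<^sub>k\<close> sum to \<open>1\<close>, and \<open>e\<^sub>i\<^sub>k\<close> is equivalent to \<open>e\<^sub>i\<close>. Two simple
  modules \<open>S\<close>, \<open>S'\<close> with \<open>e S \<noteq> 0\<close> and \<open>e S' \<noteq> 0\<close> for the same local idempotent \<open>e\<close> are isomorphic:
  for nonzero \<open>s = e s\<close> and \<open>s' = e s'\<close> the map \<open>a s \<mapsto> a s'\<close> is well defined, because \<open>a s' = 0 \<noteq> a s\<close>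
  would yield an element \<open>c\<close> of the corner ring with \<open>c s = s\<close> and \<open>c s' = 0\<close>, so that neither \<open>c\<close> nor
  \<open>e - c\<close> could be invertible. Since \<open>e\<^sub>i D\<^sub>j \<noteq> 0\<close> only for \<open>i = j\<close>, this classifies the simple modules.
  That \<open>D\<^sub>j\<close> is a module at all uses that the \<open>\<lambda>\<^sub>i\<close> are distinct: a composite
  \<open>E[t]/(t\<^sup>a) \<rightarrow> E[t]/(t\<^sup>b) \<rightarrow> E[t]/(t\<^sup>a)\<close> with \<open>a \<noteq> b\<close> vanishes modulo \<open>t\<close>.

  For the principal indecomposables, a nonzero idempotent \<open>q\<close> admits \<open>x \<in> q A e\<^sub>i\<^sub>k\<close> and \<open>y \<in> e\<^sub>i\<^sub>k A q\<close>
  with \<open>y x = e\<^sub>i\<^sub>k\<close> for some \<open>i\<close>, \<open>k\<close>. Then \<open>x y\<close> is a nonzero idempotent of \<open>q A q\<close>, equal to \<open>q\<close> if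
  \<open>A q\<close> is indecomposable, and so \<open>A q \<cong> A e\<^sub>i\<^sub>k \<cong> P\<^sub>i\<close>.\<close>


section \<open>Left modules\<close>

context left_module
begin

lemma smult_r_null: "a \<in> carrier R \<Longrightarrow> a \<odot>\<^bsub>M\<^esub> \<zero>\<^bsub>M\<^esub> = \<zero>\<^bsub>M\<^esub>"
  using smult_r_distr[of a "\<zero>\<^bsub>M\<^esub>" "\<zero>\<^bsub>M\<^esub>"] smult_closed[of a "\<zero>\<^bsub>M\<^esub>"] by simp

lemma smult_l_null: "x \<in> carrier M \<Longrightarrow> \<zero>\<^bsub>R\<^esub> \<odot>\<^bsub>M\<^esub> x = \<zero>\<^bsub>M\<^esub>"
  using smult_l_distr[of "\<zero>\<^bsub>R\<^esub>" "\<zero>\<^bsub>R\<^esub>" x] smult_closed[of "\<zero>\<^bsub>R\<^esub>" x] by simp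

lemma smult_l_minus:
  assumes "a \<in> carrier R" "x \<in> carrier M"
  shows "(\<ominus>\<^bsub>R\<^esub> a) \<odot>\<^bsub>M\<^esub> x = \<ominus>\<^bsub>M\<^esub> (a \<odot>\<^bsub>M\<^esub> x)"
  by (metis assms M.minus_equality R.a_inv_closed R.l_neg smult_closed smult_l_distr smult_l_null)

lemma smult_l_diff:
  assumes "a \<in> carrier R" "b \<in> carrier R" "x \<in> carrier M"
  shows "(a \<ominus>\<^bsub>R\<^esub> b) \<odot>\<^bsub>M\<^esub> x = a \<odot>\<^bsub>M\<^esub> x \<ominus>\<^bsub>M\<^esub> b \<odot>\<^bsub>M\<^esub> x"
  using assms by (simp add: R.minus_eq M.minus_eq smult_l_distr smult_l_minus)

lemma smult_l_diff_zero_iff: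
  assumes "a \<in> carrier R" "b \<in> carrier R" "x \<in> carrier M"
  shows "(a \<ominus>\<^bsub>R\<^esub> b) \<odot>\<^bsub>M\<^esub> x = \<zero>\<^bsub>M\<^esub> \<longleftrightarrow> a \<odot>\<^bsub>M\<^esub> x = b \<odot>\<^bsub>M\<^esub> x"
  unfolding smult_l_diff[OF assms] M.minus_eq
  by (metis assms smult_closed M.minus_equality M.minus_minus M.a_inv_closed M.r_neg)

text \<open>Additive inverses are multiples by \<open>\<ominus> \<one>\<close>, so closure under
  them follows from closure under scalars.\<close>

lemma submoduleI:
  assumes "H \<subseteq> carrier M" "\<zero>\<^bsub>M\<^esub> \<in> H"
    and "\<And>x y. x \<in> H \<Longrightarrow> y \<in> H \<Longrightarrow> x \<oplus>\<^bsub>M\<^esub> y \<in> H"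
    and "\<And>a x. a \<in> carrier R \<Longrightarrow> x \<in> H \<Longrightarrow> a \<odot>\<^bsub>M\<^esub> x \<in> H"
  shows "submodule H R M"
proof -
  have "inv\<^bsub>add_monoid M\<^esub> x \<in> H" if "x \<in> H" for x
  proof -
    have "\<ominus>\<^bsub>M\<^esub> x = (\<ominus>\<^bsub>R\<^esub> \<one>\<^bsub>R\<^esub>) \<odot>\<^bsub>M\<^esub> x"
      using that assms(1) by (simp add: smult_l_minus smult_one subset_iff)
    then show ?thesis using that assms(4) by (metis R.a_inv_closed R.one_closed a_inv_def)
  qed
  then show ?thesis
    using assms by (intro submodule.intro subgroup.intro) (auto simp: submodule_axioms_def)
qed

end

lemma submoduleD:
  assumes "submodule H R M"
  shows "H \<subseteq> carrier M" "\<zero>\<^bsub>M\<^esub> \<in> H"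
    and "\<And>x y. x \<in> H \<Longrightarrow> y \<in> H \<Longrightarrow> x \<oplus>\<^bsub>M\<^esub> y \<in> H"
    and "\<And>a x. a \<in> carrier R \<Longrightarrow> x \<in> H \<Longrightarrow> a \<odot>\<^bsub>M\<^esub> x \<in> H"
    and "\<And>x. x \<in> H \<Longrightarrow> \<ominus>\<^bsub>M\<^esub> x \<in> H"
proof -
  interpret submodule H R M by fact
  show "H \<subseteq> carrier M" "\<zero>\<^bsub>M\<^esub> \<in> H" using subset one_closed by auto
  show "\<And>x y. x \<in> H \<Longrightarrow> y \<in> H \<Longrightarrow> x \<oplus>\<^bsub>M\<^esub> y \<in> H" using m_closed by auto
  show "\<And>a x. a \<in> carrier R \<Longrightarrow> x \<in> H \<Longrightarrow> a \<odot>\<^bsub>M\<^esub> x \<in> H" by auto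
  show "\<And>x. x \<in> H \<Longrightarrow> \<ominus>\<^bsub>M\<^esub> x \<in> H" using m_inv_closed by (auto simp: a_inv_def)
qed

text \<open>The existence of negatives is traded for \<open>smult_null\<close>: once
  \<open>0 x = 0\<close> is known, \<open>(- 1) x\<close> is a negative of \<open>x\<close>. This
  spares exhibiting negatives in each concrete module.\<close>

lemma left_moduleI:
  fixes R :: "('a, 'x) ring_scheme" and M :: "('a, 'b) module"
  assumes "ring R"
    and "\<And>x y. x \<in> carrier M \<Longrightarrow> y \<in> carrier M \<Longrightarrow> x \<oplus>\<^bsub>M\<^esub> y \<in> carrier M"
    and "\<zero>\<^bsub>M\<^esub> \<in> carrier M"
    and "\<And>x y z. x \<in> carrier M \<Longrightarrow> y \<in> carrier M \<Longrightarrow> z \<in> carrier M \<Longrightarrow>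
      (x \<oplus>\<^bsub>M\<^esub> y) \<oplus>\<^bsub>M\<^esub> z = x \<oplus>\<^bsub>M\<^esub> (y \<oplus>\<^bsub>M\<^esub> z)"
    and "\<And>x y. x \<in> carrier M \<Longrightarrow> y \<in> carrier M \<Longrightarrow> x \<oplus>\<^bsub>M\<^esub> y = y \<oplus>\<^bsub>M\<^esub> x"
    and "\<And>x. x \<in> carrier M \<Longrightarrow> \<zero>\<^bsub>M\<^esub> \<oplus>\<^bsub>M\<^esub> x = x"
    and smult_closed: "\<And>a x. a \<in> carrier R \<Longrightarrow> x \<in> carrier M \<Longrightarrow> a \<odot>\<^bsub>M\<^esub> x \<in> carrier M"
    and l_distr: "\<And>a b x. a \<in> carrier R \<Longrightarrow> b \<in> carrier R \<Longrightarrow> x \<in> carrier M \<Longrightarrow>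
        (a \<oplus>\<^bsub>R\<^esub> b) \<odot>\<^bsub>M\<^esub> x = a \<odot>\<^bsub>M\<^esub> x \<oplus>\<^bsub>M\<^esub> b \<odot>\<^bsub>M\<^esub> x"
    and "\<And>a x y. a \<in> carrier R \<Longrightarrow> x \<in> carrier M \<Longrightarrow> y \<in> carrier M \<Longrightarrow>
        a \<odot>\<^bsub>M\<^esub> (x \<oplus>\<^bsub>M\<^esub> y) = a \<odot>\<^bsub>M\<^esub> x \<oplus>\<^bsub>M\<^esub> a \<odot>\<^bsub>M\<^esub> y"
    and "\<And>a b x. a \<in> carrier R \<Longrightarrow> b \<in> carrier R \<Longrightarrow> x \<in> carrier M \<Longrightarrow>
        (a \<otimes>\<^bsub>R\<^esub> b) \<odot>\<^bsub>M\<^esub> x = a \<odot>\<^bsub>M\<^esub> (b \<odot>\<^bsub>M\<^esub> x)"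
    and smult_one: "\<And>x. x \<in> carrier M \<Longrightarrow> \<one>\<^bsub>R\<^esub> \<odot>\<^bsub>M\<^esub> x = x"
    and smult_null: "\<And>x. x \<in> carrier M \<Longrightarrow> \<zero>\<^bsub>R\<^esub> \<odot>\<^bsub>M\<^esub> x = \<zero>\<^bsub>M\<^esub>"
  shows "left_module R M"
proof -
  interpret R: ring R by fact
  have "\<exists>y\<in>carrier M. y \<oplus>\<^bsub>M\<^esub> x = \<zero>\<^bsub>M\<^esub>" if "x \<in> carrier M" for x
  proof
    show "(\<ominus>\<^bsub>R\<^esub> \<one>\<^bsub>R\<^esub>) \<odot>\<^bsub>M\<^esub> x \<in> carrier M" using that smult_closed by auto
    show "(\<ominus>\<^bsub>R\<^esub> \<one>\<^bsub>R\<^esub>) \<odot>\<^bsub>M\<^esub> x \<oplus>\<^bsub>M\<^esub> x = \<zero>\<^bsub>M\<^esub>"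
      using l_distr[of "\<ominus>\<^bsub>R\<^esub> \<one>\<^bsub>R\<^esub>" "\<one>\<^bsub>R\<^esub>" x] that smult_one smult_null by (simp add: R.l_neg)
  qed
  then have "abelian_group M"
    using assms by (intro abelian_groupI) auto
  then show ?thesis
    using assms by (intro left_module.intro left_module_axioms.intro) auto
qed

lemma submodule_is_left_module:
  fixes R :: "('a, 'x) ring_scheme" and M :: "('a, 'b) module"
  assumes "left_module R M" "submodule H R M"
  shows "left_module R (M\<lparr>carrier := H\<rparr>)"
proof -
  interpret left_module R M by fact
  note H = submoduleD[OF assms(2)]
  show ?thesis
    by (rule left_moduleI)
      (use H R.ring_axioms in \<open>auto simp: subset_iff M.a_assoc smult_l_distr smult_r_distr
         smult_assoc smult_one smult_l_null intro: M.a_comm\<close>)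
qed

text \<open>The orbit \<open>R x\<close> is a submodule containing \<open>x\<close>, hence nonzero,
  and simplicity makes it everything.\<close>

lemma simple_module_cyclic:
  fixes R :: "('a, 'x) ring_scheme" and M :: "('a, 'b) module"
  assumes "simple_module R M" "x \<in> carrier M" "x \<noteq> \<zero>\<^bsub>M\<^esub>" "y \<in> carrier M"
  shows "\<exists>a\<in>carrier R. a \<odot>\<^bsub>M\<^esub> x = y"
proof -
  interpret left_module R M using assms(1) by (simp add: simple_module_def)
  let ?N = "(\<lambda>a. a \<odot>\<^bsub>M\<^esub> x) ` carrier R"
  have "submodule ?N R M"
  proof (rule submoduleI)
    show "?N \<subseteq> carrier M" using assms smult_closed by auto
    show "\<zero>\<^bsub>M\<^esub> \<in> ?N" using smult_l_null[OF assms(2)] by (metis R.zero_closed imageI)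
    show "u \<oplus>\<^bsub>M\<^esub> v \<in> ?N" if "u \<in> ?N" "v \<in> ?N" for u v
      using that assms(2) by (auto simp: smult_l_distr[symmetric])
    show "a \<odot>\<^bsub>M\<^esub> u \<in> ?N" if "a \<in> carrier R" "u \<in> ?N" for a u
      using that assms(2) by (auto simp: smult_assoc[symmetric])
  qed
  moreover have "x \<in> ?N" using smult_one[OF assms(2)] by (metis R.one_closed imageI)
  ultimately have "?N = carrier M"
    using assms unfolding simple_module_def by blast
  then show ?thesis using assms(4) by (metis (no_types, lifting) imageE)
qed

section \<open>The regular module and module homomorphisms\<close>

lemma regular_module_simps [simp]:
  "carrier (regular_module R) = carrier R" "\<zero>\<^bsub>regular_module R\<^esub> = \<zero>\<^bsub>R\<^esub>"
  "ring.add (regular_module R) = ring.add R" "module.smult (regular_module R) = monoid.mult R"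
  by (simp_all add: regular_module_def)

lemma regular_submodule_simps [simp]:
  "carrier (regular_submodule R P) = P" "\<zero>\<^bsub>regular_submodule R P\<^esub> = \<zero>\<^bsub>R\<^esub>"
  "ring.add (regular_submodule R P) = ring.add R"
  "module.smult (regular_submodule R P) = monoid.mult R"
  by (simp_all add: regular_submodule_def)

lemma (in ring) regular_left_module: "left_module R (regular_module R)"
  by (rule left_moduleI) (auto simp: a_assoc l_distr r_distr m_assoc ring_axioms intro: a_comm)

lemma mod_homsI:
  assumes "\<And>x. x \<in> carrier M \<Longrightarrow> f x \<in> carrier N"
    and "\<And>x. x \<notin> carrier M \<Longrightarrow> f x = undefined"
    and "\<And>x y. x \<in> carrier M \<Longrightarrow> y \<in> carrier M \<Longrightarrow> f (x \<oplus>\<^bsub>M\<^esub> y) = f x \<oplus>\<^bsub>N\<^esub> f y"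
    and "\<And>a x. a \<in> carrier R \<Longrightarrow> x \<in> carrier M \<Longrightarrow> f (a \<odot>\<^bsub>M\<^esub> x) = a \<odot>\<^bsub>N\<^esub> f x"
  shows "f \<in> mod_homs R M N"
  using assms unfolding mod_homs_def by blast

lemma mod_homsD:
  assumes "f \<in> mod_homs R M N"
  shows "\<And>x. x \<in> carrier M \<Longrightarrow> f x \<in> carrier N"
    and "\<And>x. x \<notin> carrier M \<Longrightarrow> f x = undefined"
    and "\<And>x y. x \<in> carrier M \<Longrightarrow> y \<in> carrier M \<Longrightarrow> f (x \<oplus>\<^bsub>M\<^esub> y) = f x \<oplus>\<^bsub>N\<^esub> f y"
    and "\<And>a x. a \<in> carrier R \<Longrightarrow> x \<in> carrier M \<Longrightarrow> f (a \<odot>\<^bsub>M\<^esub> x) = a \<odot>\<^bsub>N\<^esub> f x"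
  using assms unfolding mod_homs_def by (blast dest: PiE_mem PiE_arb)+

lemma mod_homs_zero:
  fixes M :: "('a, 'b) module" and N :: "('a, 'c) module"
  assumes "left_module R M" "left_module R N" "f \<in> mod_homs R M N"
  shows "f \<zero>\<^bsub>M\<^esub> = \<zero>\<^bsub>N\<^esub>"
proof -
  interpret M: left_module R M by fact
  interpret N: left_module R N by fact
  have "f (\<zero>\<^bsub>R\<^esub> \<odot>\<^bsub>M\<^esub> \<zero>\<^bsub>M\<^esub>) = \<zero>\<^bsub>R\<^esub> \<odot>\<^bsub>N\<^esub> f \<zero>\<^bsub>M\<^esub>"
    using mod_homsD(4)[OF assms(3)] by simp
  then show ?thesis
    using mod_homsD(1)[OF assms(3)] by (simp add: M.smult_l_null N.smult_l_null)
qed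


section \<open>Local idempotents\<close>

text \<open>This says that the corner ring \<open>e R e\<close>, with unit \<open>e\<close>, is
  local. The inverses are sought in all of \<open>R\<close>, which amounts to the same: an inverse
  \<open>c'\<close> of \<open>c\<close> may be replaced by \<open>e c' e\<close>.\<close>

definition local_idem :: "('a, 'x) ring_scheme \<Rightarrow> 'a \<Rightarrow> bool" where
  "local_idem R e \<longleftrightarrow> e \<in> carrier R \<and> e \<otimes>\<^bsub>R\<^esub> e = e \<and> e \<noteq> \<zero>\<^bsub>R\<^esub> \<and>
     (\<forall>c\<in>carrier R. \<forall>d\<in>carrier R. e \<otimes>\<^bsub>R\<^esub> c \<otimes>\<^bsub>R\<^esub> e = c \<longrightarrow> e \<otimes>\<^bsub>R\<^esub> d \<otimes>\<^bsub>R\<^esub> e = d \<longrightarrow>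
        c \<oplus>\<^bsub>R\<^esub> d = e \<longrightarrow>
        (\<exists>c'\<in>carrier R. c' \<otimes>\<^bsub>R\<^esub> c = e \<and> c \<otimes>\<^bsub>R\<^esub> c' = e) \<or>
        (\<exists>d'\<in>carrier R. d' \<otimes>\<^bsub>R\<^esub> d = e \<and> d \<otimes>\<^bsub>R\<^esub> d' = e))"

definition left_ideal_gen :: "('a, 'x) ring_scheme \<Rightarrow> 'a \<Rightarrow> 'a set" where
  "left_ideal_gen R e = {a \<otimes>\<^bsub>R\<^esub> e | a. a \<in> carrier R}"

context ring
begin

text \<open>The form in which locality is applied: the second summand is taken to be
  \<open>e - c\<close>, which again lies in the corner, and only left inverses are kept.\<close>

lemma local_idem_cases:
  assumes "local_idem R e" "c \<in> carrier R" "e \<otimes> c \<otimes> e = c"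
  shows "(\<exists>c'\<in>carrier R. c' \<otimes> c = e) \<or> (\<exists>d'\<in>carrier R. d' \<otimes> (e \<ominus> c) = e)"
proof -
  have e: "e \<in> carrier R" "e \<otimes> e = e" using assms(1) by (auto simp: local_idem_def)
  have ec: "e \<otimes> c = c" "c \<otimes> e = c"
    using e assms(2,3) by (metis m_assoc m_closed)+
  have "e \<otimes> (e \<ominus> c) \<otimes> e = e \<ominus> c"
    using e ec assms(2) by (simp add: minus_eq l_distr r_distr l_minus r_minus)
  moreover have "c \<oplus> (e \<ominus> c) = e"
    using e assms(2) by (simp add: minus_eq a_comm[of e] r_neg2)
  ultimately show ?thesis
    using assms e unfolding local_idem_def by (metis minus_closed)
qed

text \<open>Simplicity is asked of \<open>M\<close> alone, since only \<open>s\<close> has to be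
  recovered from \<open>a s\<close>. For two simple modules the lemma applies in both directions,
  and the annihilators of \<open>s\<close> and \<open>d\<close> coincide.\<close>

lemma annihilator_le:
  fixes M :: "('a, 'c) module" and N :: "('a, 'd) module"
  assumes M: "simple_module R M" and N: "left_module R N" and e: "local_idem R e"
    and s: "s \<in> carrier M" "s \<noteq> \<zero>\<^bsub>M\<^esub>" "e \<odot>\<^bsub>M\<^esub> s = s"
    and d: "d \<in> carrier N" "d \<noteq> \<zero>\<^bsub>N\<^esub>" "e \<odot>\<^bsub>N\<^esub> d = d"
    and a: "a \<in> carrier R" "a \<odot>\<^bsub>N\<^esub> d = \<zero>\<^bsub>N\<^esub>"
  shows "a \<odot>\<^bsub>M\<^esub> s = \<zero>\<^bsub>M\<^esub>"
proof (rule ccontr)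
  interpret M: left_module R M using M by (simp add: simple_module_def)
  interpret N: left_module R N by fact
  assume "a \<odot>\<^bsub>M\<^esub> s \<noteq> \<zero>\<^bsub>M\<^esub>"
  then obtain b where b: "b \<in> carrier R" "b \<odot>\<^bsub>M\<^esub> (a \<odot>\<^bsub>M\<^esub> s) = s"
    using simple_module_cyclic[OF M] M.smult_closed a s by metis
  have ec: "e \<in> carrier R" "e \<otimes> e = e" using e by (auto simp: local_idem_def)
  \<comment> \<open>Compressing \<open>b a\<close> to the corner of \<open>e\<close> makes locality
    applicable; the result still fixes \<open>s\<close> and kills \<open>d\<close>, because
    \<open>e\<close> fixes both vectors.\<close>
  define c where "c = e \<otimes> (b \<otimes> a) \<otimes> e"
  have c: "c \<in> carrier R" using ec a b by (simp add: c_def)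
  have ece: "e \<otimes> c \<otimes> e = c"
    using ec a b by (simp add: c_def m_assoc) (simp add: m_assoc[symmetric])
  have cs: "c \<odot>\<^bsub>M\<^esub> s = s"
    using ec a b s by (simp add: c_def M.smult_assoc)
  have cd: "c \<odot>\<^bsub>N\<^esub> d = \<zero>\<^bsub>N\<^esub>"
    using ec a b d by (simp add: c_def N.smult_assoc N.smult_r_null)
  consider (unit) c' where "c' \<in> carrier R" "c' \<otimes> c = e"
    | (co_unit) d' where "d' \<in> carrier R" "d' \<otimes> (e \<ominus> c) = e"
    using local_idem_cases[OF e c ece] by blast
  \<comment> \<open>A left inverse of \<open>c\<close> gives \<open>d = e d = c' (c d) = 0\<close>;
    a left inverse of \<open>e - c\<close> gives
    \<open>s = e s = d' ((e - c) s) = 0\<close>.\<close>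
  then show False
  proof cases
    case (unit c')
    then show False using N.smult_assoc[of c' c d] c cd d by (simp add: N.smult_r_null)
  next
    case (co_unit d')
    have "(e \<ominus> c) \<odot>\<^bsub>M\<^esub> s = \<zero>\<^bsub>M\<^esub>"
      using ec c s cs by (simp add: M.smult_l_diff M.minus_eq M.r_neg)
    then show False using M.smult_assoc[of d' "e \<ominus> c" s] co_unit ec c s by (simp add: M.smult_r_null)
  qed
qed

text \<open>Both modules are cyclic, generated by \<open>s\<close> and \<open>d\<close>, and these
  generators have the same annihilator; so \<open>a s \<mapsto> a d\<close> is a well-defined
  bijection.\<close>

lemma simple_modules_iso:
  fixes M :: "('a, 'c) module" and N :: "('a, 'd) module"
  assumes M: "simple_module R M" and N: "simple_module R N" and e: "local_idem R e"
    and s: "s \<in> carrier M" "s \<noteq> \<zero>\<^bsub>M\<^esub>" "e \<odot>\<^bsub>M\<^esub> s = s"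
    and d: "d \<in> carrier N" "d \<noteq> \<zero>\<^bsub>N\<^esub>" "e \<odot>\<^bsub>N\<^esub> d = d"
  shows "mod_iso R M N"
proof -
  interpret M: left_module R M using M by (simp add: simple_module_def)
  interpret N: left_module R N using N by (simp add: simple_module_def)
  have eq_iff: "a \<odot>\<^bsub>M\<^esub> s = b \<odot>\<^bsub>M\<^esub> s \<longleftrightarrow> a \<odot>\<^bsub>N\<^esub> d = b \<odot>\<^bsub>N\<^esub> d"
    if "a \<in> carrier R" "b \<in> carrier R" for a b
  proof -
    have "(a \<ominus> b) \<odot>\<^bsub>M\<^esub> s = \<zero>\<^bsub>M\<^esub> \<longleftrightarrow> (a \<ominus> b) \<odot>\<^bsub>N\<^esub> d = \<zero>\<^bsub>N\<^esub>"
      using annihilator_le[OF M N.left_module_axioms e s d]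
        annihilator_le[OF N M.left_module_axioms e d s] that by auto
    then show ?thesis
      using that s d by (simp add: M.smult_l_diff_zero_iff N.smult_l_diff_zero_iff)
  qed
  \<comment> \<open>A chosen coefficient of \<open>x\<close> with respect to the generator
    \<open>s\<close>; by \<open>eq_iff\<close> the choice does not affect \<open>g x\<close> applied
    to \<open>d\<close>.\<close>
  define g where "g x = (SOME a. a \<in> carrier R \<and> a \<odot>\<^bsub>M\<^esub> s = x)" for x
  have g: "g x \<in> carrier R" "g x \<odot>\<^bsub>M\<^esub> s = x" if "x \<in> carrier M" for x
    using someI_ex[of "\<lambda>a. a \<in> carrier R \<and> a \<odot>\<^bsub>M\<^esub> s = x"] simple_module_cyclic[OF M s(1,2) that]
    unfolding g_def by blast+
  define f where "f = (\<lambda>x\<in>carrier M. g x \<odot>\<^bsub>N\<^esub> d)"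
  have f: "f (a \<odot>\<^bsub>M\<^esub> s) = a \<odot>\<^bsub>N\<^esub> d" if "a \<in> carrier R" for a
    using that g[of "a \<odot>\<^bsub>M\<^esub> s"] s M.smult_closed eq_iff[of "g (a \<odot>\<^bsub>M\<^esub> s)" a] by (simp add: f_def)
  have "f \<in> mod_homs R M N"
  proof (rule mod_homsI)
    show "f x \<in> carrier N" if "x \<in> carrier M" for x
      using that g d by (simp add: f_def N.smult_closed)
    show "f x = undefined" if "x \<notin> carrier M" for x using that by (simp add: f_def)
    show "f (x \<oplus>\<^bsub>M\<^esub> y) = f x \<oplus>\<^bsub>N\<^esub> f y" if "x \<in> carrier M" "y \<in> carrier M" for x y
    proof -
      have "f (x \<oplus>\<^bsub>M\<^esub> y) = f ((g x \<oplus> g y) \<odot>\<^bsub>M\<^esub> s)"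
        using that g s by (simp add: M.smult_l_distr)
      also have "\<dots> = f x \<oplus>\<^bsub>N\<^esub> f y"
        using that g d f by (simp add: N.smult_l_distr) (simp add: f_def)
      finally show ?thesis .
    qed
    show "f (a \<odot>\<^bsub>M\<^esub> x) = a \<odot>\<^bsub>N\<^esub> f x" if "a \<in> carrier R" "x \<in> carrier M" for a x
    proof -
      have "f (a \<odot>\<^bsub>M\<^esub> x) = f ((a \<otimes> g x) \<odot>\<^bsub>M\<^esub> s)"
        using that g s by (simp add: M.smult_assoc)
      also have "\<dots> = a \<odot>\<^bsub>N\<^esub> f x"
        using that g d f by (simp add: N.smult_assoc) (simp add: f_def)
      finally show ?thesis .
    qed
  qed
  moreover have "bij_betw f (carrier M) (carrier N)"
  proof (rule bij_betwI')
    show "f x = f y \<longleftrightarrow> x = y" if "x \<in> carrier M" "y \<in> carrier M" for x y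
      using that eq_iff[of "g x" "g y"] g by (simp add: f_def)
    show "f x \<in> carrier N" if "x \<in> carrier M" for x
      using that g d by (simp add: f_def N.smult_closed)
    show "\<exists>x\<in>carrier M. y = f x" if "y \<in> carrier N" for y
      using simple_module_cyclic[OF N d(1,2) that] f M.smult_closed s by metis
  qed
  ultimately show ?thesis by (auto simp: mod_iso_def)
qed

section \<open>Left ideals generated by an idempotent\<close>

lemma left_ideal_gen_submodule:
  assumes "e \<in> carrier R"
  shows "submodule (left_ideal_gen R e) R (regular_module R)"
proof -
  interpret M: left_module R "regular_module R" by (rule regular_left_module)
  show ?thesis
  proof (rule M.submoduleI)
    show "left_ideal_gen R e \<subseteq> carrier (regular_module R)"
      using assms by (auto simp: left_ideal_gen_def)
    show "\<zero>\<^bsub>regular_module R\<^esub> \<in> left_ideal_gen R e"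
      using assms by (auto simp: left_ideal_gen_def intro!: exI[of _ \<zero>])
    show "x \<oplus>\<^bsub>regular_module R\<^esub> y \<in> left_ideal_gen R e"
      if "x \<in> left_ideal_gen R e" "y \<in> left_ideal_gen R e" for x y
      using that assms unfolding left_ideal_gen_def
      by (auto simp: l_distr[symmetric])
    show "a \<odot>\<^bsub>regular_module R\<^esub> x \<in> left_ideal_gen R e"
      if "a \<in> carrier R" "x \<in> left_ideal_gen R e" for a x
      using that assms unfolding left_ideal_gen_def by (auto simp: m_assoc[symmetric])
  qed
qed

lemma left_ideal_gen_left_module:
  assumes "e \<in> carrier R"
  shows "left_module R (regular_submodule R (left_ideal_gen R e))"
  unfolding regular_submodule_def
  by (rule submodule_is_left_module[OF regular_left_module left_ideal_gen_submodule[OF assms]])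

lemma mem_left_ideal_gen:
  assumes "e \<in> carrier R" "e \<otimes> e = e"
  shows "x \<in> left_ideal_gen R e \<longleftrightarrow> x \<in> carrier R \<and> x \<otimes> e = x"
  using assms unfolding left_ideal_gen_def by (auto simp: m_assoc) metis

lemma submodule_of_left_ideal_gen:
  assumes "e \<in> carrier R" "submodule N R (regular_submodule R (left_ideal_gen R e))"
  shows "N \<subseteq> left_ideal_gen R e" "\<And>x. x \<in> N \<Longrightarrow> x \<in> carrier R"
    "\<zero> \<in> N" "\<And>x y. x \<in> N \<Longrightarrow> y \<in> N \<Longrightarrow> x \<oplus> y \<in> N" "\<And>a x. a \<in> carrier R \<Longrightarrow> x \<in> N \<Longrightarrow> a \<otimes> x \<in> N"
    "\<And>x. x \<in> N \<Longrightarrow> \<ominus> x \<in> N"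
proof -
  note D = submoduleD[OF assms(2), simplified]
  show "N \<subseteq> left_ideal_gen R e" "\<zero> \<in> N" "\<And>x y. x \<in> N \<Longrightarrow> y \<in> N \<Longrightarrow> x \<oplus> y \<in> N"
    and sm: "\<And>a x. a \<in> carrier R \<Longrightarrow> x \<in> N \<Longrightarrow> a \<otimes> x \<in> N"
    using D by auto
  show car: "\<And>x. x \<in> N \<Longrightarrow> x \<in> carrier R"
    using D(1) assms(1) by (auto simp: left_ideal_gen_def)
  show "\<ominus> x \<in> N" if "x \<in> N" for x
    using sm[of "\<ominus> \<one>" x] that car[OF that] by (simp add: l_minus)
qed

text \<open>A decomposition of \<open>R e\<close> splits \<open>e\<close> into two orthogonal
  idempotents of the corner ring. One of them is a unit there, so one summand contains
  \<open>e\<close> and is all of \<open>R e\<close>.\<close>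

lemma local_idem_indecomposable:
  assumes e: "local_idem R e"
  shows "indecomposable_module R (regular_submodule R (left_ideal_gen R e))" (is "indecomposable_module R ?P")
  unfolding indecomposable_module_def
proof (intro conjI allI impI)
  have ec: "e \<in> carrier R" "e \<otimes> e = e" "e \<noteq> \<zero>" using e by (auto simp: local_idem_def)
  show "left_module R ?P" by (rule left_ideal_gen_left_module[OF ec(1)])
  show "carrier ?P \<noteq> {\<zero>\<^bsub>?P\<^esub>}" using ec mem_left_ideal_gen[OF ec(1,2), of e] by auto
  fix N N' assume "internal_direct_sum R ?P N N'"
  then have sub: "submodule N R ?P" "submodule N' R ?P" and
    sum: "N <+>\<^bsub>?P\<^esub> N' = left_ideal_gen R e" and int: "N \<inter> N' = {\<zero>}"
    by (auto simp: internal_direct_sum_def)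
  note N = submodule_of_left_ideal_gen[OF ec(1) sub(1)]
  note N' = submodule_of_left_ideal_gen[OF ec(1) sub(2)]
  have me: "x \<otimes> e = x" if "x \<in> N \<or> x \<in> N'" for x
    using that N(1) N'(1) mem_left_ideal_gen[OF ec(1,2)] by auto
  have "e \<in> N <+>\<^bsub>?P\<^esub> N'" using sum mem_left_ideal_gen[OF ec(1,2), of e] ec by auto
  then obtain n n' where n: "n \<in> N" "n' \<in> N'" "e = n \<oplus> n'"
    by (auto simp: set_add_def')
  have nc: "n \<in> carrier R" "n' \<in> carrier R" using n N N' by auto
  have sub0: "x = \<zero>" if "x \<in> N" "x \<in> N'" for x using that int by auto
  \<comment> \<open>Right multiplication by \<open>e = n + n'\<close> fixes \<open>n\<close> and
    \<open>n'\<close>. As both summands are left ideals, \<open>n n' = n - n n\<close> lies in both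
    and vanishes; likewise \<open>n' n\<close>.\<close>
  have split: "n = n \<otimes> n \<oplus> n \<otimes> n'" "n' = n' \<otimes> n \<oplus> n' \<otimes> n'"
    using me[of n] me[of n'] n nc by (simp_all add: r_distr[symmetric])
  have solve: "b = a \<oplus> \<ominus> c" "c = a \<oplus> \<ominus> b" if "a = b \<oplus> c" "b \<in> carrier R" "c \<in> carrier R" for a b c
    using that by (simp add: a_assoc r_neg, simp add: a_comm[of b c] a_assoc r_neg)
  have "n \<otimes> n' \<in> N"
    using solve(2)[OF split(1)] N(4)[OF n(1) N(6)[OF N(5)[OF nc(1) n(1)]]] nc by simp
  then have nn': "n \<otimes> n' = \<zero>" using sub0 N'(5)[OF nc(1) n(2)] by simp
  have "n' \<otimes> n \<in> N'"
    using solve(1)[OF split(2)] N'(4)[OF n(2) N'(6)[OF N'(5)[OF nc(2) n(2)]]] nc by simp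
  then have n'n: "n' \<otimes> n = \<zero>" using sub0 N(5)[OF nc(2) n(1)] by simp
  have "n \<otimes> n = n" "n' \<otimes> n' = n'" using split nn' n'n nc by (metis m_closed r_zero l_zero)+
  \<comment> \<open>Being orthogonal idempotents with sum \<open>e\<close>, both are fixed by
    \<open>e\<close> from the left as well, which places them in the corner ring.\<close>
  then have en: "e \<otimes> n = n" "e \<otimes> n' = n'"
    using n(3) nc nn' n'n by (simp_all add: l_distr)
  have "e \<otimes> n \<otimes> e = n" "e \<otimes> n' \<otimes> e = n'" using en me n by simp_all
  then have "(\<exists>c'\<in>carrier R. c' \<otimes> n = e) \<or> (\<exists>c'\<in>carrier R. c' \<otimes> n' = e)"
    using e n(3) nc unfolding local_idem_def by metis
  then have e_mem: "e \<in> N \<or> e \<in> N'" using N(5)[OF _ n(1)] N'(5)[OF _ n(2)] by metis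
  moreover have "x = \<zero>" if "e \<in> N" "x \<in> N'" for x
    using sub0 that me[of x] N(5)[of x e] N'(2) by metis
  moreover have "x = \<zero>" if "e \<in> N'" "x \<in> N" for x
    using sub0 that me[of x] N'(5)[of x e] N(2) by metis
  ultimately show "N = {\<zero>\<^bsub>?P\<^esub>} \<or> N' = {\<zero>\<^bsub>?P\<^esub>}" using e_mem N(3) N'(3) by auto
qed

text \<open>The Peirce decomposition \<open>x = x e + x (1 - e)\<close>; an \<open>x\<close> in both
  parts satisfies \<open>x = x (1 - e) = x e (1 - e) = 0\<close>.\<close>

lemma left_ideal_gen_summand:
  assumes e: "e \<in> carrier R" "e \<otimes> e = e"
  shows "internal_direct_sum R (regular_module R) (left_ideal_gen R e) (left_ideal_gen R (\<one> \<ominus> e))"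
  unfolding internal_direct_sum_def
proof (intro conjI)
  let ?f = "\<one> \<ominus> e"
  have f: "?f \<in> carrier R" "?f \<otimes> ?f = ?f" "e \<otimes> ?f = \<zero>"
    using e by (simp_all add: minus_eq r_distr l_distr l_minus r_minus r_neg)
  show "submodule (left_ideal_gen R e) R (regular_module R)" by (rule left_ideal_gen_submodule[OF e(1)])
  show "submodule (left_ideal_gen R ?f) R (regular_module R)"
    by (rule left_ideal_gen_submodule[OF f(1)])
  have "x \<in> left_ideal_gen R e <+>\<^bsub>regular_module R\<^esub> left_ideal_gen R ?f" if "x \<in> carrier R" for x
  proof -
    have "x = x \<otimes> e \<oplus> x \<otimes> ?f" using that e by (simp add: minus_eq r_distr r_minus a_lcomm r_neg)
    then show ?thesis using that by (auto simp: set_add_def' left_ideal_gen_def)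
  qed
  then show "left_ideal_gen R e <+>\<^bsub>regular_module R\<^esub> left_ideal_gen R ?f = carrier (regular_module R)"
    using e f by (auto simp: set_add_def' left_ideal_gen_def)
  have "x = \<zero>" if "x \<in> left_ideal_gen R e" "x \<in> left_ideal_gen R ?f" for x
    using that e f mem_left_ideal_gen[OF e] mem_left_ideal_gen[OF f(1,2)]
    by (metis m_assoc r_null)
  moreover have "\<zero> \<in> left_ideal_gen R e" "\<zero> \<in> left_ideal_gen R ?f"
    using e f mem_left_ideal_gen[OF e, of \<zero>] mem_left_ideal_gen[OF f(1,2), of \<zero>] by simp_all
  ultimately show "left_ideal_gen R e \<inter> left_ideal_gen R ?f = {\<zero>\<^bsub>regular_module R\<^esub>}"
    unfolding regular_module_simps by blast
qed

lemma local_idem_principal_indecomposable: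
  "local_idem R e \<Longrightarrow> principal_indecomposable R (left_ideal_gen R e)"
  unfolding principal_indecomposable_def
  using local_idem_indecomposable left_ideal_gen_summand by (metis local_idem_def)

text \<open>Right multiplication by \<open>x\<close> and by \<open>y\<close> are mutually inverse:
  on \<open>R q\<close> one has \<open>a x y = a q = a\<close>, on \<open>R e\<close> one has
  \<open>b y x = b e = b\<close>.\<close>

lemma left_ideal_gen_iso:
  assumes e: "e \<in> carrier R" "e \<otimes> e = e" and q: "q \<in> carrier R" "q \<otimes> q = q"
    and x: "x \<in> carrier R" "y \<in> carrier R" "x \<otimes> y = q" "y \<otimes> x = e"
  shows "mod_iso R (regular_submodule R (left_ideal_gen R q)) (regular_submodule R (left_ideal_gen R e))"
proof -
  note memq = mem_left_ideal_gen[OF q] and meme = mem_left_ideal_gen[OF e]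
  \<comment> \<open>Associativity of \<open>x y x\<close> and \<open>y x y\<close> replaces any
    assumption that \<open>x\<close> and \<open>y\<close> lie between the two idempotents.\<close>
  have eq: "q \<otimes> x = x \<otimes> e" "e \<otimes> y = y \<otimes> q" using x by (metis m_assoc)+
  have to_e: "a \<otimes> x \<in> left_ideal_gen R e" if "a \<in> left_ideal_gen R q" for a
  proof -
    have "a \<otimes> x \<otimes> e = a \<otimes> q \<otimes> x" using that memq x e q eq by (metis m_assoc)
    then show ?thesis using that memq meme x by simp
  qed
  have to_q: "b \<otimes> y \<in> left_ideal_gen R q" if "b \<in> left_ideal_gen R e" for b
  proof -
    have "b \<otimes> y \<otimes> q = b \<otimes> e \<otimes> y" using that meme x e q eq by (metis m_assoc)
    then show ?thesis using that memq meme x by simp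
  qed
  let ?f = "\<lambda>a\<in>left_ideal_gen R q. a \<otimes> x"
  have "?f \<in> mod_homs R (regular_submodule R (left_ideal_gen R q)) (regular_submodule R (left_ideal_gen R e))"
  proof (rule mod_homsI)
    show "?f (a \<oplus>\<^bsub>regular_submodule R (left_ideal_gen R q)\<^esub> b) =
        ?f a \<oplus>\<^bsub>regular_submodule R (left_ideal_gen R e)\<^esub> ?f b"
      if "a \<in> carrier (regular_submodule R (left_ideal_gen R q))"
        "b \<in> carrier (regular_submodule R (left_ideal_gen R q))" for a b
    proof -
      have "a \<oplus> b \<in> left_ideal_gen R q" using that q by (auto simp: memq l_distr)
      then show ?thesis using that memq x by (simp add: l_distr)
    qed
    show "?f (a \<odot>\<^bsub>regular_submodule R (left_ideal_gen R q)\<^esub> b) =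
        a \<odot>\<^bsub>regular_submodule R (left_ideal_gen R e)\<^esub> ?f b"
      if "a \<in> carrier R" "b \<in> carrier (regular_submodule R (left_ideal_gen R q))" for a b
    proof -
      have "a \<otimes> b \<in> left_ideal_gen R q" using that q by (auto simp: memq m_assoc)
      then show ?thesis using that memq x by (simp add: m_assoc)
    qed
  qed (use to_e in auto)
  moreover have "bij_betw ?f (left_ideal_gen R q) (left_ideal_gen R e)"
  proof (rule bij_betw_byWitness[where f' = "\<lambda>b. b \<otimes> y"])
    show "\<forall>a\<in>left_ideal_gen R q. ?f a \<otimes> y = a" using memq x by (simp add: m_assoc)
    show "\<forall>b\<in>left_ideal_gen R e. ?f (b \<otimes> y) = b" using meme x to_q by (simp add: m_assoc)
  qed (use to_e to_q in auto)
  ultimately show ?thesis unfolding mod_iso_def by (intro bexI[of _ ?f]) simp_all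
qed

text \<open>For an isomorphism \<open>f\<close>, take \<open>x = f q\<close> and \<open>y\<close>
  the preimage of \<open>e\<close>; linearity gives \<open>y x = f (y q) = f y = e\<close>.\<close>

lemma left_ideal_gen_isoD:
  assumes e: "e \<in> carrier R" "e \<otimes> e = e" and q: "q \<in> carrier R" "q \<otimes> q = q"
    and iso: "mod_iso R (regular_submodule R (left_ideal_gen R q)) (regular_submodule R (left_ideal_gen R e))"
  obtains x y where "x \<in> carrier R" "y \<in> carrier R" "q \<otimes> x = x" "y \<otimes> x = e"
proof -
  let ?Q = "left_ideal_gen R q" and ?E = "left_ideal_gen R e"
  note memq = mem_left_ideal_gen[OF q] and meme = mem_left_ideal_gen[OF e]
  obtain f where f: "f \<in> mod_homs R (regular_submodule R ?Q) (regular_submodule R ?E)"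
    and bij: "bij_betw f ?Q ?E"
    using iso by (auto simp: mod_iso_def)
  note fD = mod_homsD[OF f, simplified]
  have "e \<in> ?E" "q \<in> ?Q" using meme memq e q by auto
  then obtain y where y: "y \<in> ?Q" "f y = e" using bij by (metis bij_betw_imp_surj_on imageE)
  show thesis
  proof
    show "f q \<in> carrier R" "y \<in> carrier R" using fD(1)[OF \<open>q \<in> ?Q\<close>] y memq meme by auto
    show "q \<otimes> f q = f q" using fD(4)[of q q] q \<open>q \<in> ?Q\<close> by simp
    show "y \<otimes> f q = e" using fD(4)[of y q] \<open>q \<in> ?Q\<close> y memq by simp
  qed
qed

text \<open>If every \<open>e\<^sub>k q b e\<^sub>k\<close> were a non-unit of the local ring \<open>e\<^sub>k R e\<^sub>k\<close>, then by locality
  adjoining \<open>e\<^sub>k\<close> to a left ideal containing \<open>1 - q\<close> could never produce the unit ideal unless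
  \<open>e\<^sub>k\<close> already lies in it; as the \<open>e\<^sub>k\<close> together generate, \<open>R (1 - q) = R\<close>.\<close>

lemma idempotent_hits_local_idem:
  assumes fin: "finite I" and loc: "\<And>k. k \<in> I \<Longrightarrow> local_idem R (e k)"
    and gen: "\<And>L. submodule L R (regular_module R) \<Longrightarrow> (\<And>k. k \<in> I \<Longrightarrow> e k \<in> L) \<Longrightarrow> \<one> \<in> L"
    and q: "q \<in> carrier R" "q \<otimes> q = q" "q \<noteq> \<zero>"
  obtains k b c where "k \<in> I" "b \<in> carrier R" "c \<in> carrier R" "c \<otimes> (e k \<otimes> q \<otimes> b \<otimes> e k) = e k"
proof (rule ccontr)
  interpret M: left_module R "regular_module R" by (rule regular_left_module)
  assume "\<not> thesis"
  then have no: "c \<otimes> (e k \<otimes> q \<otimes> b \<otimes> e k) \<noteq> e k"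
    if "k \<in> I" "b \<in> carrier R" "c \<in> carrier R" for k b c
    using that \<open>\<And>k b c. k \<in> I \<Longrightarrow> b \<in> carrier R \<Longrightarrow> c \<in> carrier R \<Longrightarrow> c \<otimes> (e k \<otimes> q \<otimes> b \<otimes> e k) = e k \<Longrightarrow> thesis\<close>
    by blast
  have ec: "e k \<in> carrier R" "e k \<otimes> e k = e k" if "k \<in> I" for k
    using loc[OF that] by (auto simp: local_idem_def)
  have one_mem: "\<one> \<in> L" if "submodule L R (regular_module R)" "\<one> \<ominus> q \<in> L" for L
    using that
  \<comment> \<open>The measure counts the \<open>e k\<close> still missing from \<open>L\<close>.
    Adjoining \<open>R e k\<close> for a missing \<open>k\<close> lowers it, so by induction the
    enlarged ideal contains \<open>\<one>\<close>.\<close>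
  proof (induction "card {k \<in> I. e k \<notin> L}" arbitrary: L rule: less_induct)
    case less
    note L = submoduleD[OF less.prems(1), simplified]
    show ?case
    proof (rule gen[OF less.prems(1)])
      fix k assume k: "k \<in> I"
      show "e k \<in> L"
      proof (rule ccontr)
        assume nk: "e k \<notin> L"
        define L' where "L' = {l \<oplus> b \<otimes> e k | l b. l \<in> L \<and> b \<in> carrier R}"
        have L'I: "l \<oplus> b \<otimes> e k \<in> L'" if "l \<in> L" "b \<in> carrier R" for l b
          using that by (auto simp: L'_def)
        have sub: "submodule L' R (regular_module R)"
        proof (rule M.submoduleI)
          show "L' \<subseteq> carrier (regular_module R)" using L(1) ec[OF k] by (auto simp: L'_def)
          show "\<zero>\<^bsub>regular_module R\<^esub> \<in> L'" using L'I[OF L(2) zero_closed] ec[OF k] by simp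
          show "x \<oplus>\<^bsub>regular_module R\<^esub> y \<in> L'" if xy: "x \<in> L'" "y \<in> L'" for x y
          proof -
            obtain l b l' b' where *: "x = l \<oplus> b \<otimes> e k" "l \<in> L" "b \<in> carrier R"
              "y = l' \<oplus> b' \<otimes> e k" "l' \<in> L" "b' \<in> carrier R"
              using xy by (auto simp: L'_def)
            have "l \<in> carrier R" "l' \<in> carrier R" using * L(1) by auto
            then have "x \<oplus> y = (l \<oplus> l') \<oplus> (b \<oplus> b') \<otimes> e k"
              using * ec[OF k] by (simp add: l_distr a_ac)
            then show ?thesis using L'I[OF L(3)[of l l'], of "b \<oplus> b'"] * by simp
          qed
          show "a \<odot>\<^bsub>regular_module R\<^esub> x \<in> L'" if ax: "a \<in> carrier R" "x \<in> L'" for a x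
          proof -
            obtain l b where *: "x = l \<oplus> b \<otimes> e k" "l \<in> L" "b \<in> carrier R"
              using ax by (auto simp: L'_def)
            have "l \<in> carrier R" using * L(1) by auto
            then have "a \<otimes> x = a \<otimes> l \<oplus> (a \<otimes> b) \<otimes> e k"
              using * ax ec[OF k] by (simp add: r_distr m_assoc)
            then show ?thesis using L'I[OF L(4)[of a l], of "a \<otimes> b"] * ax by simp
          qed
        qed
        have LL': "l \<in> L'" if "l \<in> L" for l
          using L'I[OF that zero_closed] L(1) that ec[OF k] by (auto simp: subset_iff)
        have "e k \<in> L'" using L'I[OF L(2) one_closed] ec[OF k] by simp
        then have "{j \<in> I. e j \<notin> L'} \<subset> {j \<in> I. e j \<notin> L}" using LL' nk k by blast
        then have "card {j \<in> I. e j \<notin> L'} < card {j \<in> I. e j \<notin> L}"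
          using fin by (intro psubset_card_mono) auto
        from less.hyps[OF this sub LL'[OF less.prems(2)]]
        obtain l b where l: "\<one> = l \<oplus> b \<otimes> e k" "l \<in> L" "b \<in> carrier R" by (auto simp: L'_def)
        have lc: "l \<in> carrier R" using l L(1) by auto
        define c where "c = e k \<otimes> q \<otimes> b \<otimes> e k"
        have c: "c \<in> carrier R" "e k \<otimes> c \<otimes> e k = c"
          using ec[OF k] q l by (simp_all add: c_def m_assoc) (simp add: m_assoc[symmetric])
        consider (unit) c' where "c' \<in> carrier R" "c' \<otimes> c = e k"
          | (co_unit) d where "d \<in> carrier R" "d \<otimes> (e k \<ominus> c) = e k"
          using local_idem_cases[OF loc[OF k] c] by blast
        then show False
        proof cases
          case (unit c')
          then show False using no[OF k l(3)] by (simp add: c_def)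
        next
          case (co_unit d)
          \<comment> \<open>Multiplying \<open>1 = l + b e k\<close> by \<open>e k q\<close> on the
            left exhibits \<open>c\<close> as the part outside \<open>L\<close>: the remainder
            \<open>e k - c\<close> is \<open>e k (1 - q) + e k q l\<close> and lies in
            \<open>L\<close>. Its left inverse would then put \<open>e k\<close> into
            \<open>L\<close>.\<close>
          have "e k \<otimes> q = e k \<otimes> q \<otimes> l \<oplus> c"
            using l lc ec[OF k] q by (metis c_def m_assoc m_closed r_distr r_one)
          moreover have "e k = e k \<otimes> (\<one> \<ominus> q) \<oplus> e k \<otimes> q"
            using ec[OF k] q by (simp add: minus_eq r_distr r_minus a_assoc l_neg)
          ultimately have "e k = (e k \<otimes> (\<one> \<ominus> q) \<oplus> e k \<otimes> q \<otimes> l) \<oplus> c"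
            using ec[OF k] q lc c by (simp add: a_assoc)
          then have "e k \<ominus> c = (e k \<otimes> (\<one> \<ominus> q) \<oplus> e k \<otimes> q \<otimes> l)"
            using ec[OF k] q lc c by (metis add.inv_solve_right' minus_eq m_closed add.m_closed minus_closed one_closed)
          moreover have "\<dots> \<in> L"
            using L(3)[OF L(4)[OF _ less.prems(2)] L(4)[OF _ l(2)]] ec[OF k] q by simp
          ultimately have "e k \<ominus> c \<in> L" by (simp only:)
          from L(4)[OF co_unit(1) this] show False using co_unit(2) nk by simp
        qed
      qed
    qed
  qed
  have f: "\<one> \<ominus> q \<in> carrier R" "\<one> \<ominus> q \<in> left_ideal_gen R (\<one> \<ominus> q)"
    using q by (auto simp: left_ideal_gen_def intro!: exI[of _ \<one>])
  have "\<one> \<in> left_ideal_gen R (\<one> \<ominus> q)"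
    by (rule one_mem[OF left_ideal_gen_submodule[OF f(1)] f(2)])
  then obtain a where "a \<in> carrier R" "\<one> = a \<otimes> (\<one> \<ominus> q)" by (auto simp: left_ideal_gen_def)
  \<comment> \<open>Multiplying \<open>1 = a (1 - q)\<close> by \<open>q\<close> on the right yields
    \<open>q = 0\<close>, a contradiction.\<close>
  moreover have "(\<one> \<ominus> q) \<otimes> q = \<zero>" using q by (simp add: minus_eq l_distr l_minus r_neg)
  ultimately have "\<one> \<otimes> q = \<zero>" using q f by (metis m_assoc r_null)
  then show False using q by simp
qed

text \<open>The generator is the component \<open>p\<close> of \<open>\<one>\<close> in
  \<open>P\<close>. For \<open>x\<close> in \<open>P\<close> the difference
  \<open>x - x p = x q\<close> lies in both summands, so \<open>x = x p\<close>.\<close>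

lemma summand_idempotent:
  assumes "internal_direct_sum R (regular_module R) P Q"
  obtains q where "q \<in> carrier R" "q \<otimes> q = q" "P = left_ideal_gen R q"
proof -
  have sub: "submodule P R (regular_module R)" "submodule Q R (regular_module R)"
    and sum: "P <+>\<^bsub>regular_module R\<^esub> Q = carrier R" and int: "P \<inter> Q = {\<zero>}"
    using assms by (auto simp: internal_direct_sum_def)
  note P = submoduleD[OF sub(1), simplified] and Q = submoduleD[OF sub(2), simplified]
  have "\<one> \<in> P <+>\<^bsub>regular_module R\<^esub> Q" using sum by simp
  then obtain p q where pq: "p \<in> P" "q \<in> Q" "\<one> = p \<oplus> q" by (auto simp: set_add_def')
  have c: "p \<in> carrier R" "q \<in> carrier R" using pq P(1) Q(1) by auto
  have idem: "x \<otimes> p = x" if "x \<in> P" for x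
  proof -
    have x: "x \<in> carrier R" using that P(1) by auto
    then have "x = x \<otimes> p \<oplus> x \<otimes> q" using pq c by (metis r_distr r_one)
    then have eq: "x \<otimes> q = x \<oplus> (\<ominus> \<one>) \<otimes> (x \<otimes> p)"
      using x c by (simp add: l_minus) (metis a_comm add.inv_solve_right' m_closed)
    have "x \<oplus> (\<ominus> \<one>) \<otimes> (x \<otimes> p) \<in> P"
      using P(3)[OF that P(4)[OF _ P(4)[OF x pq(1)]]] by simp
    then have "x \<otimes> q \<in> P" by (simp only: eq)
    then have "x \<otimes> q = \<zero>" using Q(4)[OF x pq(2)] int by auto
    with \<open>x = x \<otimes> p \<oplus> x \<otimes> q\<close> show ?thesis using x c by (metis m_closed r_zero)
  qed
  show thesis
  proof
    show "p \<in> carrier R" "p \<otimes> p = p" using c idem pq by auto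
    show "P = left_ideal_gen R p"
      using mem_left_ideal_gen[OF c(1) idem[OF pq(1)]] idem P(1,4) pq(1) c by (auto simp: subset_iff) metis
  qed
qed

text \<open>A corner idempotent \<open>g\<close> splits \<open>R q\<close> as the direct sum of
  \<open>R g\<close> and \<open>R (q - g)\<close>; with \<open>g\<close> nonzero, the second summand
  must vanish.\<close>

lemma indecomposable_idempotent:
  assumes q: "q \<in> carrier R" "q \<otimes> q = q"
    and ind: "indecomposable_module R (regular_submodule R (left_ideal_gen R q))"
    and g: "g \<in> carrier R" "g \<otimes> g = g" "q \<otimes> g = g" "g \<otimes> q = g" "g \<noteq> \<zero>"
  shows "g = q"
proof -
  let ?P = "regular_submodule R (left_ideal_gen R q)"
  interpret P: left_module R ?P by (rule left_ideal_gen_left_module[OF q(1)])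
  define h where "h = q \<ominus> g"
  have h: "h \<in> carrier R" "h \<otimes> h = h" "h \<otimes> q = h" "g \<otimes> h = \<zero>"
    using q g by (simp_all add: h_def minus_eq l_distr r_distr l_minus r_minus r_neg)
  note memq = mem_left_ideal_gen[OF q] and memg = mem_left_ideal_gen[OF g(1,2)]
    and memh = mem_left_ideal_gen[OF h(1,2)]
  have sub: "submodule (left_ideal_gen R f) R ?P"
    if f: "f \<in> carrier R" "f \<otimes> f = f" "f \<otimes> q = f" for f
  proof (rule P.submoduleI)
    note F = submoduleD[OF left_ideal_gen_submodule[OF f(1)], simplified]
    show "left_ideal_gen R f \<subseteq> carrier ?P"
      using mem_left_ideal_gen[OF f(1,2)] memq q f by (auto) (metis m_assoc)
  qed (use submoduleD[OF left_ideal_gen_submodule[OF f(1)], simplified] in auto)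
  have "internal_direct_sum R ?P (left_ideal_gen R g) (left_ideal_gen R h)"
    unfolding internal_direct_sum_def
  proof (intro conjI)
    show "submodule (left_ideal_gen R g) R ?P" "submodule (left_ideal_gen R h) R ?P"
      using sub g h by auto
    have "x = x \<otimes> g \<oplus> x \<otimes> h" if "x \<in> left_ideal_gen R q" for x
      using that memq q g h by (simp add: h_def minus_eq r_distr r_minus a_lcomm r_neg)
    then have "x \<in> left_ideal_gen R g <+>\<^bsub>?P\<^esub> left_ideal_gen R h" if "x \<in> left_ideal_gen R q" for x
      using that memq by (auto simp: set_add_def' left_ideal_gen_def)
    moreover have "x \<oplus> y \<in> left_ideal_gen R q" if "x \<in> left_ideal_gen R g" "y \<in> left_ideal_gen R h" for x y
      using that submoduleD(1)[OF sub[OF g(1,2,4)]] submoduleD(1)[OF sub[OF h(1,2,3)]]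
        P.add.m_closed[of x y] by auto
    ultimately show "left_ideal_gen R g <+>\<^bsub>?P\<^esub> left_ideal_gen R h = carrier ?P"
      by (auto simp: set_add_def')
    have "x = \<zero>" if "x \<in> left_ideal_gen R g" "x \<in> left_ideal_gen R h" for x
      using that memg memh h g by (metis m_assoc r_null)
    moreover have "\<zero> \<in> left_ideal_gen R g" "\<zero> \<in> left_ideal_gen R h"
      using g h memg[of \<zero>] memh[of \<zero>] by simp_all
    ultimately show "left_ideal_gen R g \<inter> left_ideal_gen R h = {\<zero>\<^bsub>?P\<^esub>}"
      unfolding regular_submodule_simps by blast
  qed
  then have "left_ideal_gen R g = {\<zero>} \<or> left_ideal_gen R h = {\<zero>}"
    using ind by (auto simp: indecomposable_module_def)
  moreover have "g \<in> left_ideal_gen R g" "h \<in> left_ideal_gen R h" using memg memh g h by auto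
  ultimately have "h = \<zero>" using g by auto
  then show ?thesis using q g by (simp add: h_def)
qed

text \<open>The \<open>e k\<close> supply enough local idempotents to generate the ring, as
  \<open>gen\<close> expresses; \<open>rep\<close> reduces this possibly redundant family to the
  representatives \<open>f i\<close> up to equivalence of idempotents.\<close>

lemma principal_indecomposable_complete:
  assumes fin: "finite I" and loc: "\<And>k. k \<in> I \<Longrightarrow> local_idem R (e k)"
    and gen: "\<And>L. submodule L R (regular_module R) \<Longrightarrow> (\<And>k. k \<in> I \<Longrightarrow> e k \<in> L) \<Longrightarrow> \<one> \<in> L"
    and rep: "\<And>k. k \<in> I \<Longrightarrow> \<exists>i\<in>J. \<exists>u\<in>carrier R. \<exists>v\<in>carrier R.
      f i \<in> carrier R \<and> f i \<otimes> f i = f i \<and> u \<otimes> v = e k \<and> v \<otimes> u = f i"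
    and P: "principal_indecomposable R P"
  shows "\<exists>i\<in>J. mod_iso R (regular_submodule R P) (regular_submodule R (left_ideal_gen R (f i)))"
proof -
  obtain q where q: "q \<in> carrier R" "q \<otimes> q = q" and Pq: "P = left_ideal_gen R q"
    using P summand_idempotent unfolding principal_indecomposable_def by metis
  have ind: "indecomposable_module R (regular_submodule R (left_ideal_gen R q))"
    using P Pq by (simp add: principal_indecomposable_def)
  have "q \<noteq> \<zero>"
  proof
    assume "q = \<zero>"
    then have "left_ideal_gen R q = {\<zero>}" by (auto simp: left_ideal_gen_def intro!: exI[of _ \<zero>])
    then show False using ind by (simp add: indecomposable_module_def)
  qed
  then obtain k b c where k: "k \<in> I" and bc: "b \<in> carrier R" "c \<in> carrier R" "c \<otimes> (e k \<otimes> q \<otimes> b \<otimes> e k) = e k"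
    using idempotent_hits_local_idem[of I e q] fin loc gen q by metis
  have ek: "e k \<in> carrier R" "e k \<otimes> e k = e k" "e k \<noteq> \<zero>" using loc[OF k] by (auto simp: local_idem_def)
  obtain i u v where i: "i \<in> J" and uv: "u \<in> carrier R" "v \<in> carrier R" "u \<otimes> v = e k" "v \<otimes> u = f i"
    and fi: "f i \<in> carrier R" "f i \<otimes> f i = f i" using rep[OF k] by metis
  \<comment> \<open>Both are chosen so that \<open>y x = c e q q b e\<close> collapses to
    \<open>e\<close>, where \<open>e\<close> stands for \<open>e k\<close>. Then \<open>x y\<close>
    is an idempotent in the corner of \<open>q\<close>, nonzero since
    \<open>y (x y) x = e\<close>.\<close>
  define x where "x = q \<otimes> b \<otimes> e k"
  define y where "y = c \<otimes> e k \<otimes> q"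
  have xy: "x \<in> carrier R" "y \<in> carrier R" using q bc ek by (auto simp: x_def y_def)
  have yx: "y \<otimes> x = e k"
  proof -
    have "y \<otimes> x = c \<otimes> (e k \<otimes> (q \<otimes> q) \<otimes> b \<otimes> e k)" using q(1) bc ek(1) by (simp add: x_def y_def m_assoc)
    then show ?thesis using q bc by simp
  qed
  have xe: "x \<otimes> e k = x" using q bc ek by (simp add: x_def m_assoc)
  have "x \<otimes> y = q"
  proof (rule indecomposable_idempotent[OF q ind])
    show "x \<otimes> y \<in> carrier R" using xy by simp
    have "x \<otimes> y \<otimes> (x \<otimes> y) = x \<otimes> (y \<otimes> x) \<otimes> y" using xy by (simp add: m_assoc)
    then show "x \<otimes> y \<otimes> (x \<otimes> y) = x \<otimes> y" using yx xe by simp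
    have "q \<otimes> x = (q \<otimes> q) \<otimes> b \<otimes> e k" using q(1) bc ek(1) by (simp add: x_def m_assoc)
    then have "q \<otimes> x = x" using q by (simp add: x_def)
    then show "q \<otimes> (x \<otimes> y) = x \<otimes> y" using q xy by (simp add: m_assoc[symmetric])
    have "y \<otimes> q = y" using q bc ek by (simp add: y_def m_assoc)
    then show "x \<otimes> y \<otimes> q = x \<otimes> y" using q xy by (simp add: m_assoc)
    show "x \<otimes> y \<noteq> \<zero>"
    proof
      assume "x \<otimes> y = \<zero>"
      then have "y \<otimes> (x \<otimes> y) \<otimes> x = \<zero>" using xy by simp
      moreover have "y \<otimes> (x \<otimes> y) \<otimes> x = (y \<otimes> x) \<otimes> (y \<otimes> x)" using xy by (simp add: m_assoc)
      ultimately show False using yx ek by simp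
    qed
  qed
  \<comment> \<open>Composing with \<open>u\<close> and \<open>v\<close> carries the equivalence
    between \<open>q\<close> and \<open>e k\<close> over to one between \<open>q\<close> and
    \<open>f i\<close>.\<close>
  moreover have "(x \<otimes> u) \<otimes> (v \<otimes> y) = x \<otimes> (u \<otimes> v) \<otimes> y" using uv(1,2) xy by (simp add: m_assoc)
  ultimately have 1: "(x \<otimes> u) \<otimes> (v \<otimes> y) = q" using uv xe by simp
  have "(v \<otimes> y) \<otimes> (x \<otimes> u) = v \<otimes> (y \<otimes> x) \<otimes> u" using uv(1,2) xy by (simp add: m_assoc)
  also have "\<dots> = (v \<otimes> u) \<otimes> (v \<otimes> u)" unfolding yx uv(3)[symmetric] using uv(1,2) by (simp add: m_assoc)
  finally have 2: "(v \<otimes> y) \<otimes> (x \<otimes> u) = f i" using uv fi by simp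
  show ?thesis
    using left_ideal_gen_iso[OF fi q _ _ 1 2] xy uv i Pq by auto
qed

end


section \<open>Endomorphism rings and direct sums\<close>

lemma mod_homs_eqI:
  assumes "f \<in> mod_homs R M N" "g \<in> mod_homs R M N" "\<And>x. x \<in> carrier M \<Longrightarrow> f x = g x"
  shows "f = g"
  using mod_homsD(2)[OF assms(1)] mod_homsD(2)[OF assms(2)] assms(3) by (metis ext)

lemma endo_ring_carrier [simp]: "carrier (endo_ring R M) = mod_homs R M M"
  by (simp add: endo_ring_def)

lemma endo_ring_apply [simp]:
  assumes "x \<in> carrier M"
  shows "(f \<otimes>\<^bsub>endo_ring R M\<^esub> g) x = f (g x)" "(f \<oplus>\<^bsub>endo_ring R M\<^esub> g) x = f x \<oplus>\<^bsub>M\<^esub> g x"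
    "\<one>\<^bsub>endo_ring R M\<^esub> x = x" "\<zero>\<^bsub>endo_ring R M\<^esub> x = \<zero>\<^bsub>M\<^esub>"
  using assms by (simp_all add: endo_ring_def compose_def)

lemma endo_ring_apply_undefined [simp]:
  assumes "x \<notin> carrier M"
  shows "(f \<otimes>\<^bsub>endo_ring R M\<^esub> g) x = undefined" "(f \<oplus>\<^bsub>endo_ring R M\<^esub> g) x = undefined"
    "\<one>\<^bsub>endo_ring R M\<^esub> x = undefined" "\<zero>\<^bsub>endo_ring R M\<^esub> x = undefined"
  using assms by (simp_all add: endo_ring_def compose_def)

lemma endo_ring_ring:
  fixes R :: "('a, 'x) ring_scheme" and N :: "('a, 'd) module"
  assumes "left_module R N"
  shows "ring (endo_ring R N)"
proof -
  interpret N: left_module R N by fact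
  let ?A = "endo_ring R N"
  have add: "f \<oplus>\<^bsub>?A\<^esub> g \<in> mod_homs R N N" if f: "f \<in> mod_homs R N N" and g: "g \<in> mod_homs R N N" for f g
    by (rule mod_homsI)
      (use mod_homsD[OF f] mod_homsD[OF g] in \<open>simp_all add: N.a_ac N.smult_r_distr N.smult_closed\<close>)
  have mult: "f \<otimes>\<^bsub>?A\<^esub> g \<in> mod_homs R N N" if f: "f \<in> mod_homs R N N" and g: "g \<in> mod_homs R N N" for f g
    by (rule mod_homsI)
      (use mod_homsD[OF f] mod_homsD[OF g] in \<open>simp_all add: N.smult_closed\<close>)
  have one: "\<one>\<^bsub>?A\<^esub> \<in> mod_homs R N N"
    by (rule mod_homsI) (simp_all add: N.smult_closed)
  have zero: "\<zero>\<^bsub>?A\<^esub> \<in> mod_homs R N N"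
    by (rule mod_homsI) (simp_all add: N.smult_closed N.smult_r_null)
  have neg: "\<exists>g\<in>mod_homs R N N. g \<oplus>\<^bsub>?A\<^esub> f = \<zero>\<^bsub>?A\<^esub>" if f: "f \<in> mod_homs R N N" for f
  proof -
    let ?g = "\<lambda>x\<in>carrier N. \<ominus>\<^bsub>N\<^esub> f x"
    have uminus_smult: "a \<odot>\<^bsub>N\<^esub> (\<ominus>\<^bsub>N\<^esub> x) = \<ominus>\<^bsub>N\<^esub> (a \<odot>\<^bsub>N\<^esub> x)"
      if "a \<in> carrier R" "x \<in> carrier N" for a x
      using that N.smult_r_distr[of a "\<ominus>\<^bsub>N\<^esub> x" x]
      by (simp add: N.l_neg N.smult_r_null N.smult_closed)
        (metis N.a_inv_closed N.minus_equality N.minus_minus N.smult_closed)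
    have g: "?g \<in> mod_homs R N N"
      by (rule mod_homsI)
        (use mod_homsD[OF f] in \<open>simp_all add: N.smult_closed N.minus_add uminus_smult\<close>)
    have "?g \<oplus>\<^bsub>?A\<^esub> f = \<zero>\<^bsub>?A\<^esub>"
      by (rule mod_homs_eqI[OF add[OF g f] zero]) (use mod_homsD[OF f] in \<open>simp add: N.l_neg\<close>)
    with g show ?thesis by blast
  qed
  show ?thesis
  proof (intro ringI abelian_groupI monoidI)
    fix f g h assume f: "f \<in> carrier ?A" and g: "g \<in> carrier ?A" and h: "h \<in> carrier ?A"
    note fgh = f[simplified] g[simplified] h[simplified]
    note D = mod_homsD[OF fgh(1)] mod_homsD[OF fgh(2)] mod_homsD[OF fgh(3)]
    show "f \<oplus>\<^bsub>?A\<^esub> g \<oplus>\<^bsub>?A\<^esub> h = f \<oplus>\<^bsub>?A\<^esub> (g \<oplus>\<^bsub>?A\<^esub> h)"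
      by (rule mod_homs_eqI[of _ R N N]) (use add fgh D in \<open>auto simp: N.a_assoc\<close>)
    show "f \<otimes>\<^bsub>?A\<^esub> g \<otimes>\<^bsub>?A\<^esub> h = f \<otimes>\<^bsub>?A\<^esub> (g \<otimes>\<^bsub>?A\<^esub> h)"
      by (rule mod_homs_eqI[of _ R N N]) (use mult fgh D in auto)
    show "(f \<oplus>\<^bsub>?A\<^esub> g) \<otimes>\<^bsub>?A\<^esub> h = f \<otimes>\<^bsub>?A\<^esub> h \<oplus>\<^bsub>?A\<^esub> g \<otimes>\<^bsub>?A\<^esub> h"
      by (rule mod_homs_eqI[of _ R N N]) (use add mult fgh D in auto)
    show "h \<otimes>\<^bsub>?A\<^esub> (f \<oplus>\<^bsub>?A\<^esub> g) = h \<otimes>\<^bsub>?A\<^esub> f \<oplus>\<^bsub>?A\<^esub> h \<otimes>\<^bsub>?A\<^esub> g"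
      by (rule mod_homs_eqI[of _ R N N]) (use add mult fgh D in auto)
  next
    fix f g assume f: "f \<in> carrier ?A" and g: "g \<in> carrier ?A"
    note fg = f[simplified] g[simplified]
    note D = mod_homsD[OF fg(1)] mod_homsD[OF fg(2)]
    show "f \<oplus>\<^bsub>?A\<^esub> g \<in> carrier ?A" "f \<otimes>\<^bsub>?A\<^esub> g \<in> carrier ?A" using add mult fg by auto
    show "f \<oplus>\<^bsub>?A\<^esub> g = g \<oplus>\<^bsub>?A\<^esub> f"
      by (rule mod_homs_eqI[of _ R N N]) (use add fg D in \<open>auto intro: N.a_comm\<close>)
  next
    fix f assume f: "f \<in> carrier ?A"
    note D = mod_homsD[OF f[simplified]]
    show "\<zero>\<^bsub>?A\<^esub> \<oplus>\<^bsub>?A\<^esub> f = f"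
      by (rule mod_homs_eqI[of _ R N N]) (use add zero f D in auto)
    show "\<one>\<^bsub>?A\<^esub> \<otimes>\<^bsub>?A\<^esub> f = f" "f \<otimes>\<^bsub>?A\<^esub> \<one>\<^bsub>?A\<^esub> = f"
      by (rule mod_homs_eqI[of _ R N N]; use mult one f D in auto)+
    show "\<exists>g\<in>carrier ?A. g \<oplus>\<^bsub>?A\<^esub> f = \<zero>\<^bsub>?A\<^esub>" using neg f by simp
  qed (use one zero in auto)
qed

lemma direct_sum_simps:
  "carrier (direct_sum I N) = (\<Pi>\<^sub>E i\<in>I. carrier (N i))"
  "\<zero>\<^bsub>direct_sum I N\<^esub> = (\<lambda>i\<in>I. \<zero>\<^bsub>N i\<^esub>)"
  "x \<oplus>\<^bsub>direct_sum I N\<^esub> y = (\<lambda>i\<in>I. x i \<oplus>\<^bsub>N i\<^esub> y i)"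
  "a \<odot>\<^bsub>direct_sum I N\<^esub> x = (\<lambda>i\<in>I. a \<odot>\<^bsub>N i\<^esub> x i)"
  by (simp_all add: direct_sum_def)

lemma direct_sum_left_module:
  fixes R :: "('a, 'x) ring_scheme" and N :: "'i \<Rightarrow> ('a, 'b) module"
  assumes R: "ring R" and N: "\<And>i. i \<in> I \<Longrightarrow> left_module R (N i)"
  shows "left_module R (direct_sum I N)"
proof -
  interpret R: ring R by fact
  have ab: "abelian_group (N i)" if "i \<in> I" for i using N[OF that] by (simp add: left_module_def)
  note monoid = abelian_group.axioms(1)[OF ab]
  show ?thesis
  proof (rule left_moduleI[OF R], goal_cases)
    case (1 x y)
    then show ?case by (auto simp: direct_sum_simps intro!: abelian_monoid.a_closed[OF monoid])
  next
    case 2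
    then show ?case by (auto simp: direct_sum_simps intro!: abelian_monoid.zero_closed[OF monoid])
  next
    case (3 x y z)
    then show ?case
      by (auto simp: direct_sum_simps intro!: restrict_ext abelian_monoid.a_assoc[OF monoid])
  next
    case (4 x y)
    then show ?case
      by (auto simp: direct_sum_simps intro!: restrict_ext abelian_monoid.a_comm[OF monoid])
  next
    case (5 x)
    \<comment> \<open>Equality in the direct sum is equality of functions, so it must also be
      checked outside \<open>I\<close>, where every element is \<open>undefined\<close>.\<close>
    then have "x i \<in> carrier (N i)" if "i \<in> I" for i using that by (auto simp: direct_sum_simps)
    moreover have "x i = undefined" if "i \<notin> I" for i
      using that 5 by (metis PiE_arb direct_sum_simps(1))
    ultimately show ?case
      by (intro ext) (simp add: direct_sum_simps restrict_def abelian_monoid.l_zero[OF monoid])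
  next
    case (6 a x)
    then show ?case by (auto simp: direct_sum_simps intro!: left_module.smult_closed[OF N])
  next
    case (7 a b x)
    then show ?case
      by (auto simp: direct_sum_simps intro!: restrict_ext left_module.smult_l_distr[OF N])
  next
    case (8 a x y)
    then show ?case
      by (auto simp: direct_sum_simps intro!: restrict_ext left_module.smult_r_distr[OF N])
  next
    case (9 a b x)
    then show ?case
      by (auto simp: direct_sum_simps intro!: restrict_ext left_module.smult_assoc[OF N])
  next
    case (10 x)
    then have "x i \<in> carrier (N i)" if "i \<in> I" for i using that by (auto simp: direct_sum_simps)
    moreover have "x i = undefined" if "i \<notin> I" for i
      using that 10 by (metis PiE_arb direct_sum_simps(1))
    ultimately show ?case
      by (intro ext) (simp add: direct_sum_simps restrict_def left_module.smult_one[OF N])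
  next
    case (11 x)
    then show ?case
      by (auto simp: direct_sum_simps intro!: restrict_ext left_module.smult_l_null[OF N])
  qed
qed


section \<open>Truncated polynomial modules\<close>

lemma quotient_module_simps:
  "carrier (quotient_module R I) = a_rcosets\<^bsub>R\<^esub> I" "\<zero>\<^bsub>quotient_module R I\<^esub> = I"
  "ring.add (quotient_module R I) = ring.add (R Quot I)"
  "a \<odot>\<^bsub>quotient_module R I\<^esub> x = (I +>\<^bsub>R\<^esub> a) \<otimes>\<^bsub>R Quot I\<^esub> x"
  by (simp_all add: quotient_module_def FactRing_def)

text \<open>The action factors through the ring homomorphism from \<open>R\<close> to
  \<open>R Quot I\<close>, so the module axioms are ring axioms of the quotient.\<close>

lemma (in ideal) quotient_left_module: "left_module R (quotient_module R I)"
proof -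
  interpret Q: ring "R Quot I" by (rule quotient_is_ring)
  interpret h: ring_hom_ring R "R Quot I" "(+>) I" by (rule rcos_ring_hom_ring)
  show ?thesis
    by (rule left_moduleI)
      (simp_all add: quotient_module_def ring_axioms Q.a_ac Q.l_distr Q.r_distr Q.m_assoc)
qed

section \<open>Polynomials over a field and their constant terms\<close>

locale poly_field = field E for E :: "('e, 'x) ring_scheme" (structure)
begin

abbreviation "P \<equiv> poly_ring E"

sublocale P: domain P
  by (rule univ_poly_is_domain[OF carrier_is_subring])

lemmas X_closed = var_closed(1)[OF carrier_is_subring]
lemmas X_pow_closed = var_pow_closed[OF carrier_is_subring]
lemmas const_term_closed = const_term_simprules_shell(1)[OF carrier_is_subring]
lemmas const_term_mult = const_term_simprules_shell(2)[OF carrier_is_subring]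
lemmas const_term_add = const_term_simprules_shell(3)[OF carrier_is_subring]
lemmas const_term_uminus = const_term_simprules_shell(4)[OF carrier_is_subring]

lemma const_term_X: "const_term X = \<zero>"
  by (simp add: const_term_def eval_var)

lemma const_term_one: "const_term \<one>\<^bsub>P\<^esub> = \<one>"
  by (simp add: const_term_def univ_poly_one)

lemma const_term_zero_poly: "const_term \<zero>\<^bsub>P\<^esub> = \<zero>"
  by (simp add: const_term_def univ_poly_zero)

lemma const_closed: "c \<in> carrier E \<Longrightarrow> poly_of_const c \<in> carrier P"
  using ring_hom_closed[OF canonical_embedding_is_hom[OF carrier_is_subring]] by simp

lemma const_term_const: "c \<in> carrier E \<Longrightarrow> const_term (poly_of_const c) = c"
  by (simp add: const_term_def poly_of_const_def)

text \<open>In a coefficient list the constant term stands last, so dropping a final zero is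
  division by \<open>X\<close>. The zero polynomial is the empty list and is treated apart.\<close>

lemma const_term_eq_zeroD:
  assumes "p \<in> carrier P" "const_term p = \<zero>"
  shows "\<exists>q\<in>carrier P. p = q \<otimes>\<^bsub>P\<^esub> X"
proof (cases "p = []")
  case True
  then show ?thesis using X_closed
    by (intro bexI[of _ "\<zero>\<^bsub>P\<^esub>"]) (simp_all add: univ_poly_zero[symmetric, of E "carrier E"])
next
  case False
  have "polynomial (carrier E) p" using assms(1) by (simp add: univ_poly_carrier)
  from const_term_zero[OF carrier_is_subring this False assms(2)]
  obtain q where q: "polynomial (carrier E) q" "q \<noteq> []" "p = q @ [\<zero>]" by metis
  then have "q \<in> carrier P" by (simp add: univ_poly_carrier)
  with q show ?thesis using poly_mult_var[OF carrier_is_subring] by auto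
qed

lemma const_term_X_pow: "n > 0 \<Longrightarrow> const_term (X [^]\<^bsub>P\<^esub> (n::nat)) = \<zero>"
  using X_closed X_pow_closed by (cases n) (simp_all add: const_term_mult const_term_X const_term_closed)

section \<open>Residue classes modulo \<open>t^n\<close> and their reduction modulo
  \<open>t\<close>\<close>

definition tcls :: "nat \<Rightarrow> 'e list \<Rightarrow> 'e list set" where
  "tcls n p = PIdl\<^bsub>P\<^esub> (X [^]\<^bsub>P\<^esub> n) +>\<^bsub>P\<^esub> p"

lemma ideal_X_pow: "ideal (PIdl\<^bsub>P\<^esub> (X [^]\<^bsub>P\<^esub> (n::nat))) P"
  by (rule P.cgenideal_ideal[OF X_pow_closed])

lemma trunc_left_module: "left_module P (trunc_poly E n)"
  unfolding trunc_poly_def by (rule ideal.quotient_left_module[OF ideal_X_pow])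

lemma trunc_carrier: "carrier (trunc_poly E n) = tcls n ` carrier P"
  by (auto simp: trunc_poly_def quotient_module_simps A_RCOSETS_def' tcls_def)

lemma tcls_closed: "p \<in> carrier P \<Longrightarrow> tcls n p \<in> carrier (trunc_poly E n)"
  by (simp add: trunc_carrier)

lemma tcls_add:
  assumes "p \<in> carrier P" "q \<in> carrier P"
  shows "tcls n p \<oplus>\<^bsub>trunc_poly E n\<^esub> tcls n q = tcls n (p \<oplus>\<^bsub>P\<^esub> q)"
proof -
  interpret I: ideal "PIdl\<^bsub>P\<^esub> (X [^]\<^bsub>P\<^esub> n)" P by (rule ideal_X_pow)
  show ?thesis using assms
    by (simp add: trunc_poly_def quotient_module_simps tcls_def FactRing_def I.a_rcos_sum)
qed

lemma tcls_smult:
  assumes "p \<in> carrier P" "q \<in> carrier P"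
  shows "p \<odot>\<^bsub>trunc_poly E n\<^esub> tcls n q = tcls n (p \<otimes>\<^bsub>P\<^esub> q)"
proof -
  interpret I: ideal "PIdl\<^bsub>P\<^esub> (X [^]\<^bsub>P\<^esub> n)" P by (rule ideal_X_pow)
  show ?thesis using assms
    by (simp add: trunc_poly_def quotient_module_simps tcls_def FactRing_def I.rcoset_mult_add)
qed

lemma tcls_eq_zero_iff:
  assumes "p \<in> carrier P"
  shows "tcls n p = \<zero>\<^bsub>trunc_poly E n\<^esub> \<longleftrightarrow> (\<exists>s\<in>carrier P. p = s \<otimes>\<^bsub>P\<^esub> X [^]\<^bsub>P\<^esub> n)"
proof -
  interpret I: ideal "PIdl\<^bsub>P\<^esub> (X [^]\<^bsub>P\<^esub> n)" P by (rule ideal_X_pow)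
  have "tcls n p = \<zero>\<^bsub>trunc_poly E n\<^esub> \<longleftrightarrow> p \<in> PIdl\<^bsub>P\<^esub> (X [^]\<^bsub>P\<^esub> n)"
    unfolding trunc_poly_def quotient_module_simps tcls_def
    using assms I.a_rcos_const I.a_rcos_self by metis
  then show ?thesis unfolding cgenideal_def by blast
qed

lemma zero_tcls: "\<zero>\<^bsub>trunc_poly E n\<^esub> = tcls n \<zero>\<^bsub>P\<^esub>"
  using tcls_eq_zero_iff[OF P.zero_closed, of n] X_pow_closed by (metis P.l_null P.zero_closed)

text \<open>Representatives differ by multiples of \<open>X^n\<close>, whose constant term is zero
  for \<open>n > 0\<close>; hence \<open>the_elem\<close> in \<open>reduce\<close> is applied to a
  singleton.\<close>

lemma reduce_tcls:
  assumes "n > 0" "p \<in> carrier P"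
  shows "reduce E (tcls n p) = const_term p"
proof -
  interpret I: ideal "PIdl\<^bsub>P\<^esub> (X [^]\<^bsub>P\<^esub> n)" P by (rule ideal_X_pow)
  have "const_term q = const_term p" if q: "q \<in> tcls n p" for q
  proof -
    obtain s where "s \<in> carrier P" "q = s \<otimes>\<^bsub>P\<^esub> X [^]\<^bsub>P\<^esub> n \<oplus>\<^bsub>P\<^esub> p"
      using q unfolding tcls_def a_r_coset_def' cgenideal_def by blast
    then show ?thesis
      using assms X_pow_closed
      by (simp add: const_term_add const_term_mult const_term_X_pow const_term_closed)
  qed
  moreover have "p \<in> tcls n p" using assms I.a_rcos_self by (simp add: tcls_def)
  ultimately have "const_term ` tcls n p = {const_term p}" by blast
  then show ?thesis by (simp add: reduce_def)
qed

text \<open>A cyclic generator: homomorphisms out of \<open>E[t]/(t^n)\<close> are determined by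
  their value here.\<close>

definition gen :: "nat \<Rightarrow> 'e list set" where
  "gen n = tcls n \<one>\<^bsub>P\<^esub>"

lemma gen_closed: "gen n \<in> carrier (trunc_poly E n)"
  by (simp add: gen_def tcls_closed)

lemma tcls_eq_smult_gen: "p \<in> carrier P \<Longrightarrow> tcls n p = p \<odot>\<^bsub>trunc_poly E n\<^esub> gen n"
  by (simp add: gen_def tcls_smult)

lemma trunc_cyclic:
  assumes "x \<in> carrier (trunc_poly E n)"
  obtains p where "p \<in> carrier P" "x = p \<odot>\<^bsub>trunc_poly E n\<^esub> gen n"
  using assms by (auto simp: trunc_carrier tcls_eq_smult_gen)

lemma X_pow_smult_trunc:
  assumes "x \<in> carrier (trunc_poly E n)"
  shows "X [^]\<^bsub>P\<^esub> n \<odot>\<^bsub>trunc_poly E n\<^esub> x = \<zero>\<^bsub>trunc_poly E n\<^esub>"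
proof -
  obtain p where p: "p \<in> carrier P" "x = tcls n p" using assms by (auto simp: trunc_carrier)
  have "tcls n (p \<otimes>\<^bsub>P\<^esub> X [^]\<^bsub>P\<^esub> n) = \<zero>\<^bsub>trunc_poly E n\<^esub>"
    using p X_pow_closed by (subst tcls_eq_zero_iff) auto
  then show ?thesis using p X_pow_closed by (simp add: tcls_smult P.m_comm)
qed

context
  fixes n :: nat
  assumes n: "n > 0"
begin

lemma reduce_closed: "x \<in> carrier (trunc_poly E n) \<Longrightarrow> reduce E x \<in> carrier E"
  using n by (auto simp: trunc_carrier reduce_tcls const_term_closed)

lemma reduce_add:
  assumes "x \<in> carrier (trunc_poly E n)" "y \<in> carrier (trunc_poly E n)"
  shows "reduce E (x \<oplus>\<^bsub>trunc_poly E n\<^esub> y) = reduce E x \<oplus> reduce E y"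
  using assms n by (auto simp: trunc_carrier reduce_tcls tcls_add const_term_add)

lemma reduce_smult:
  assumes "p \<in> carrier P" "x \<in> carrier (trunc_poly E n)"
  shows "reduce E (p \<odot>\<^bsub>trunc_poly E n\<^esub> x) = const_term p \<otimes> reduce E x"
  using assms n by (auto simp: trunc_carrier reduce_tcls tcls_smult const_term_mult)

lemma reduce_gen: "reduce E (gen n) = \<one>"
  using n by (simp add: gen_def reduce_tcls const_term_one)

lemma reduce_zero: "reduce E \<zero>\<^bsub>trunc_poly E n\<^esub> = \<zero>"
  using n by (simp add: zero_tcls reduce_tcls const_term_zero_poly)

text \<open>Writing \<open>x = p gen\<close> gives \<open>f x = p f(gen)\<close>, so modulo
  \<open>t\<close> an endomorphism is multiplication by one scalar.\<close>

lemma reduce_hom: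
  assumes f: "f \<in> mod_homs P (trunc_poly E n) (trunc_poly E n)" and x: "x \<in> carrier (trunc_poly E n)"
  shows "reduce E (f x) = reduce E x \<otimes> reduce E (f (gen n))"
proof -
  obtain p where p: "p \<in> carrier P" "x = p \<odot>\<^bsub>trunc_poly E n\<^esub> gen n" using trunc_cyclic[OF x] by metis
  then show ?thesis
    using mod_homsD[OF f] gen_closed[of n]
    by (simp add: reduce_smult reduce_gen const_term_closed)
qed

lemma reduce_eq_zeroD:
  assumes "x \<in> carrier (trunc_poly E n)" "reduce E x = \<zero>"
  obtains y where "y \<in> carrier (trunc_poly E n)" "x = X \<odot>\<^bsub>trunc_poly E n\<^esub> y"
proof -
  obtain p where p: "p \<in> carrier P" "x = tcls n p" using assms by (auto simp: trunc_carrier)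
  then have "const_term p = \<zero>" using assms n by (simp add: reduce_tcls)
  then obtain q where "q \<in> carrier P" "p = q \<otimes>\<^bsub>P\<^esub> X" using const_term_eq_zeroD p by blast
  then show thesis
    using that[of "tcls n q"] p X_closed by (simp add: tcls_closed tcls_smult P.m_comm)
qed

text \<open>If \<open>c p(0) = 1\<close> then \<open>1 - c p\<close> is divisible by \<open>t\<close>, and \<open>(1 - c p)\<^sup>n\<close> has the form \<open>1 - w p\<close>.\<close>

lemma reduce_nonzero_generates:
  assumes "x \<in> carrier (trunc_poly E n)" "reduce E x \<noteq> \<zero>"
  shows "\<exists>p\<in>carrier P. p \<odot>\<^bsub>trunc_poly E n\<^esub> x = gen n"
proof -
  obtain p where p: "p \<in> carrier P" "x = tcls n p" using assms by (auto simp: trunc_carrier)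
  then have p0: "const_term p \<in> carrier E" "const_term p \<noteq> \<zero>"
    using assms n by (auto simp: reduce_tcls const_term_closed)
  define c where "c = inv (const_term p)"
  have c: "c \<in> carrier E" "c \<otimes> const_term p = \<one>"
    using p0 by (auto simp: c_def field_Units)
  define u where "u = \<one>\<^bsub>P\<^esub> \<ominus>\<^bsub>P\<^esub> poly_of_const c \<otimes>\<^bsub>P\<^esub> p"
  have u: "u \<in> carrier P" using c p by (simp add: u_def const_closed)
  have "const_term u = \<zero>"
    using c p p0 by (simp add: u_def P.minus_eq const_term_add const_term_uminus const_term_mult
        const_term_const const_term_one const_closed r_neg)
  then obtain s where s: "s \<in> carrier P" "u = s \<otimes>\<^bsub>P\<^esub> X" using const_term_eq_zeroD u by blast
  have "\<exists>w\<in>carrier P. u [^]\<^bsub>P\<^esub> k = \<one>\<^bsub>P\<^esub> \<ominus>\<^bsub>P\<^esub> w \<otimes>\<^bsub>P\<^esub> p" for k :: nat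
  proof (induction k)
    case 0
    show ?case using p by (intro bexI[of _ "\<zero>\<^bsub>P\<^esub>"]) (simp_all add: P.minus_eq)
  next
    case (Suc k)
    then obtain w where w: "w \<in> carrier P" "u [^]\<^bsub>P\<^esub> k = \<one>\<^bsub>P\<^esub> \<ominus>\<^bsub>P\<^esub> w \<otimes>\<^bsub>P\<^esub> p" by blast
    let ?c = "poly_of_const c"
    have "u [^]\<^bsub>P\<^esub> Suc k = (\<one>\<^bsub>P\<^esub> \<ominus>\<^bsub>P\<^esub> w \<otimes>\<^bsub>P\<^esub> p) \<otimes>\<^bsub>P\<^esub> (\<one>\<^bsub>P\<^esub> \<ominus>\<^bsub>P\<^esub> ?c \<otimes>\<^bsub>P\<^esub> p)"
      using w by (simp add: u_def)
    also have "\<dots> = \<one>\<^bsub>P\<^esub> \<ominus>\<^bsub>P\<^esub> (w \<oplus>\<^bsub>P\<^esub> ?c \<oplus>\<^bsub>P\<^esub> \<ominus>\<^bsub>P\<^esub> (w \<otimes>\<^bsub>P\<^esub> p \<otimes>\<^bsub>P\<^esub> ?c)) \<otimes>\<^bsub>P\<^esub> p"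
      using w(1) p(1) const_closed[OF c(1)] by algebra
    finally show ?case
      using w p const_closed[OF c(1)] by (intro bexI[of _ "w \<oplus>\<^bsub>P\<^esub> ?c \<oplus>\<^bsub>P\<^esub> \<ominus>\<^bsub>P\<^esub> (w \<otimes>\<^bsub>P\<^esub> p \<otimes>\<^bsub>P\<^esub> ?c)"]) auto
  qed
  then obtain w where w: "w \<in> carrier P" "u [^]\<^bsub>P\<^esub> n = \<one>\<^bsub>P\<^esub> \<ominus>\<^bsub>P\<^esub> w \<otimes>\<^bsub>P\<^esub> p" by blast
  \<comment> \<open>Since \<open>u = s X\<close>, the power \<open>u^n\<close> dies modulo
    \<open>t^n\<close>; with \<open>u^n = 1 - w p\<close> this makes \<open>w\<close> an inverse of
    \<open>p\<close> modulo \<open>t^n\<close>.\<close>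
  have un: "u [^]\<^bsub>P\<^esub> n = s [^]\<^bsub>P\<^esub> n \<otimes>\<^bsub>P\<^esub> X [^]\<^bsub>P\<^esub> n"
    using s X_closed by (simp add: P.nat_pow_distrib)
  have "\<one>\<^bsub>P\<^esub> = u [^]\<^bsub>P\<^esub> n \<oplus>\<^bsub>P\<^esub> w \<otimes>\<^bsub>P\<^esub> p"
    unfolding w(2) using w(1) p(1) by algebra
  then have "gen n = tcls n (u [^]\<^bsub>P\<^esub> n) \<oplus>\<^bsub>trunc_poly E n\<^esub> tcls n (w \<otimes>\<^bsub>P\<^esub> p)"
    using u w p by (simp add: gen_def tcls_add)
  also have "tcls n (u [^]\<^bsub>P\<^esub> n) = \<zero>\<^bsub>trunc_poly E n\<^esub>"
    using u un s(1) X_pow_closed by (subst tcls_eq_zero_iff) (simp_all, blast)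
  finally have "gen n = tcls n (w \<otimes>\<^bsub>P\<^esub> p)"
    using w p by (simp add: zero_tcls tcls_add)
  then show ?thesis using w p by (auto simp: tcls_smult)
qed

end

text \<open>A generator of \<open>E[t]/(t\<^sup>b)\<close> is not annihilated by \<open>t\<^sup>a\<close> for \<open>a < b\<close>.\<close>

lemma reduce_hom_longer:
  assumes ab: "0 < a" "a < b" and f: "f \<in> mod_homs P (trunc_poly E a) (trunc_poly E b)"
    and x: "x \<in> carrier (trunc_poly E a)"
  shows "reduce E (f x) = \<zero>"
proof -
  note F = mod_homsD[OF f]
  obtain p where p: "p \<in> carrier P" "f x = tcls b p" using F(1)[OF x] by (auto simp: trunc_carrier)
  have "f (X [^]\<^bsub>P\<^esub> a \<odot>\<^bsub>trunc_poly E a\<^esub> x) = tcls b (X [^]\<^bsub>P\<^esub> a \<otimes>\<^bsub>P\<^esub> p)"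
    using F(4)[OF X_pow_closed x] p X_pow_closed by (simp add: tcls_smult)
  then have "tcls b (X [^]\<^bsub>P\<^esub> a \<otimes>\<^bsub>P\<^esub> p) = \<zero>\<^bsub>trunc_poly E b\<^esub>"
    using X_pow_smult_trunc[OF x] mod_homs_zero[OF trunc_left_module trunc_left_module f] by simp
  then obtain s where s: "s \<in> carrier P" "X [^]\<^bsub>P\<^esub> a \<otimes>\<^bsub>P\<^esub> p = s \<otimes>\<^bsub>P\<^esub> X [^]\<^bsub>P\<^esub> b"
    using tcls_eq_zero_iff p X_pow_closed P.m_closed by metis
  \<comment> \<open>\<open>P\<close> is a domain, so \<open>X^a\<close> can be cancelled. What
    remains is \<open>p = s X^(b - a)\<close> with positive exponent, so the constant term of
    \<open>p\<close> is zero.\<close>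
  have "X [^]\<^bsub>P\<^esub> b = X [^]\<^bsub>P\<^esub> a \<otimes>\<^bsub>P\<^esub> X [^]\<^bsub>P\<^esub> (b - a)"
    using ab X_closed by (simp add: P.nat_pow_mult)
  then have "X [^]\<^bsub>P\<^esub> a \<otimes>\<^bsub>P\<^esub> p = X [^]\<^bsub>P\<^esub> a \<otimes>\<^bsub>P\<^esub> (s \<otimes>\<^bsub>P\<^esub> X [^]\<^bsub>P\<^esub> (b - a))"
    using s X_pow_closed by (simp add: P.m_lcomm)
  moreover have "X [^]\<^bsub>P\<^esub> a \<noteq> \<zero>\<^bsub>P\<^esub>"
    unfolding unitary_monom_eq_var_pow[OF carrier_is_subring, symmetric] monom_def univ_poly_zero by simp
  ultimately have "p = s \<otimes>\<^bsub>P\<^esub> X [^]\<^bsub>P\<^esub> (b - a)"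
    using P.m_lcancel X_pow_closed s p by (metis P.m_closed)
  then have "const_term p = \<zero>"
    using s ab X_pow_closed by (simp add: const_term_mult const_term_X_pow const_term_closed)
  then show ?thesis using p ab by (simp add: reduce_tcls)
qed

text \<open>For \<open>a < b\<close> the value \<open>f x\<close> is already divisible by
  \<open>t\<close>, and \<open>g\<close> commutes with \<open>t\<close>; for \<open>b < a\<close>
  the map \<open>g\<close> itself takes values that vanish modulo \<open>t\<close>.\<close>

lemma reduce_hom_hom:
  assumes ab: "0 < a" "0 < b" "a \<noteq> b" and f: "f \<in> mod_homs P (trunc_poly E a) (trunc_poly E b)"
    and g: "g \<in> mod_homs P (trunc_poly E b) (trunc_poly E a)" and x: "x \<in> carrier (trunc_poly E a)"
  shows "reduce E (g (f x)) = \<zero>"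
proof (cases "a < b")
  case True
  have fx: "f x \<in> carrier (trunc_poly E b)" using mod_homsD(1)[OF f x] .
  from reduce_eq_zeroD[OF ab(2) fx reduce_hom_longer[OF ab(1) True f x]]
  obtain y where y: "y \<in> carrier (trunc_poly E b)" "f x = X \<odot>\<^bsub>trunc_poly E b\<^esub> y" by metis
  then show ?thesis
    using mod_homsD[OF g] X_closed ab(1)
    by (simp add: reduce_smult const_term_X reduce_closed)
next
  case False
  then show ?thesis using reduce_hom_longer[OF ab(2) _ g] mod_homsD(1)[OF f x] ab by simp
qed

end


section \<open>The endomorphism algebra\<close>

locale partition_module = poly_field E for E :: "('e, 'x) ring_scheme" (structure) +
  fixes r :: nat and lam m :: "nat \<Rightarrow> nat"
  assumes lam_mono: "strict_mono_on {1..r} lam"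
    and lam_pos: "\<And>i. i \<in> {1..r} \<Longrightarrow> 0 < lam i"
    and m_pos: "\<And>i. i \<in> {1..r} \<Longrightarrow> 0 < m i"
begin

abbreviation "T i \<equiv> trunc_poly E (lam i)"
abbreviation "B i \<equiv> isotypic_block E (lam i) (m i)"
abbreviation "V \<equiv> E_lam E r lam m"
abbreviation "A \<equiv> M_lam E r lam m"
abbreviation "D j \<equiv> D_module E r lam m j"

lemma lam_neq: "i \<in> {1..r} \<Longrightarrow> j \<in> {1..r} \<Longrightarrow> i \<noteq> j \<Longrightarrow> lam i \<noteq> lam j"
  using strict_mono_on_imp_inj_on[OF lam_mono] unfolding inj_on_def by blast

lemma one_in_range: "i \<in> {1..r} \<Longrightarrow> 1 \<in> {1..m i}"
  using m_pos[of i] by auto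

sublocale T: left_module P "T i" for i
  by (rule trunc_left_module)

sublocale B: left_module P "B i" for i
  unfolding isotypic_block_def by (intro direct_sum_left_module P.ring_axioms trunc_left_module)

sublocale V: left_module P V
  unfolding E_lam_def by (intro direct_sum_left_module P.ring_axioms B.left_module_axioms)

sublocale A: ring A
  unfolding M_lam_def by (rule endo_ring_ring[OF V.left_module_axioms])

section \<open>Coordinates of vectors and endomorphisms\<close>

definition vec :: "(nat \<Rightarrow> nat \<Rightarrow> 'e list set) \<Rightarrow> nat \<Rightarrow> nat \<Rightarrow> 'e list set" where
  "vec f = (\<lambda>i\<in>{1..r}. \<lambda>k\<in>{1..m i}. f i k)"

lemma B_carrier: "carrier (B i) = (\<Pi>\<^sub>E k\<in>{1..m i}. carrier (T i))"
  by (simp add: isotypic_block_def direct_sum_simps)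

lemma V_carrier: "carrier V = (\<Pi>\<^sub>E i\<in>{1..r}. \<Pi>\<^sub>E k\<in>{1..m i}. carrier (T i))"
  by (simp add: E_lam_def direct_sum_simps B_carrier)

lemma vec_apply: "i \<in> {1..r} \<Longrightarrow> k \<in> {1..m i} \<Longrightarrow> vec f i k = f i k"
  by (simp add: vec_def)

lemma vec_closed:
  "(\<And>i k. i \<in> {1..r} \<Longrightarrow> k \<in> {1..m i} \<Longrightarrow> f i k \<in> carrier (T i)) \<Longrightarrow> vec f \<in> carrier V"
  unfolding V_carrier vec_def by (intro restrict_PiE_iff[THEN iffD2] ballI) blast

lemma V_component: "v \<in> carrier V \<Longrightarrow> i \<in> {1..r} \<Longrightarrow> v i \<in> carrier (B i)"
  unfolding V_carrier B_carrier by blast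

lemma B_component: "x \<in> carrier (B i) \<Longrightarrow> k \<in> {1..m i} \<Longrightarrow> x k \<in> carrier (T i)"
  unfolding B_carrier by blast

lemma V_entry: "v \<in> carrier V \<Longrightarrow> i \<in> {1..r} \<Longrightarrow> k \<in> {1..m i} \<Longrightarrow> v i k \<in> carrier (T i)"
  using V_component B_component by blast

lemma V_eqI:
  assumes "v \<in> carrier V" "w \<in> carrier V"
    and "\<And>i k. i \<in> {1..r} \<Longrightarrow> k \<in> {1..m i} \<Longrightarrow> v i k = w i k"
  shows "v = w"
proof (rule PiE_ext[of v "{1..r}" "\<lambda>i. carrier (B i)" w])
  show "v \<in> (\<Pi>\<^sub>E i\<in>{1..r}. carrier (B i))" "w \<in> (\<Pi>\<^sub>E i\<in>{1..r}. carrier (B i))"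
    using assms by (simp_all add: V_carrier B_carrier)
  fix i assume i: "i \<in> {1..r}"
  show "v i = w i"
    by (rule PiE_ext[of _ "{1..m i}" "\<lambda>_. carrier (T i)"])
      (use V_component[OF assms(1) i] V_component[OF assms(2) i] assms(3) i in \<open>simp_all add: B_carrier\<close>)
qed

lemma B_eqI:
  assumes "x \<in> carrier (B i)" "y \<in> carrier (B i)" "\<And>k. k \<in> {1..m i} \<Longrightarrow> x k = y k"
  shows "x = y"
  by (rule PiE_ext[of _ "{1..m i}" "\<lambda>_. carrier (T i)"]) (use assms in \<open>simp_all add: B_carrier\<close>)

lemma V_add: "i \<in> {1..r} \<Longrightarrow> k \<in> {1..m i} \<Longrightarrow> (v \<oplus>\<^bsub>V\<^esub> w) i k = v i k \<oplus>\<^bsub>T i\<^esub> w i k"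
  and V_smult: "i \<in> {1..r} \<Longrightarrow> k \<in> {1..m i} \<Longrightarrow> (p \<odot>\<^bsub>V\<^esub> v) i k = p \<odot>\<^bsub>T i\<^esub> v i k"
  and V_zero: "i \<in> {1..r} \<Longrightarrow> k \<in> {1..m i} \<Longrightarrow> \<zero>\<^bsub>V\<^esub> i k = \<zero>\<^bsub>T i\<^esub>"
  by (simp_all add: E_lam_def isotypic_block_def direct_sum_simps)

lemmas V_apply = vec_apply V_add V_smult V_zero

lemma A_carrier: "carrier A = mod_homs P V V"
  by (simp add: M_lam_def)

lemma A_closed: "a \<in> carrier A \<Longrightarrow> v \<in> carrier V \<Longrightarrow> a v \<in> carrier V"
  and A_add: "a \<in> carrier A \<Longrightarrow> v \<in> carrier V \<Longrightarrow> w \<in> carrier V \<Longrightarrow> a (v \<oplus>\<^bsub>V\<^esub> w) = a v \<oplus>\<^bsub>V\<^esub> a w"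
  and A_smult: "a \<in> carrier A \<Longrightarrow> p \<in> carrier P \<Longrightarrow> v \<in> carrier V \<Longrightarrow> a (p \<odot>\<^bsub>V\<^esub> v) = p \<odot>\<^bsub>V\<^esub> a v"
  unfolding A_carrier by (erule mod_homsD; assumption)+

lemma A_zero: "a \<in> carrier A \<Longrightarrow> a \<zero>\<^bsub>V\<^esub> = \<zero>\<^bsub>V\<^esub>"
  unfolding A_carrier by (rule mod_homs_zero[OF V.left_module_axioms V.left_module_axioms])

lemma A_apply:
  assumes "v \<in> carrier V"
  shows "(a \<otimes>\<^bsub>A\<^esub> b) v = a (b v)" "(a \<oplus>\<^bsub>A\<^esub> b) v = a v \<oplus>\<^bsub>V\<^esub> b v" "\<one>\<^bsub>A\<^esub> v = v" "\<zero>\<^bsub>A\<^esub> v = \<zero>\<^bsub>V\<^esub>"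
  using assms by (simp_all add: M_lam_def)

lemma A_eqI:
  assumes "a \<in> carrier A" "b \<in> carrier A"
    and "\<And>v i k. v \<in> carrier V \<Longrightarrow> i \<in> {1..r} \<Longrightarrow> k \<in> {1..m i} \<Longrightarrow> a v i k = b v i k"
  shows "a = b"
proof (rule mod_homs_eqI)
  show "a \<in> mod_homs P V V" "b \<in> mod_homs P V V" using assms(1,2) by (simp_all add: A_carrier)
  show "a v = b v" if "v \<in> carrier V" for v
    by (rule V_eqI) (use that assms A_closed in auto)
qed

text \<open>Lets endomorphisms be specified by coordinate formulas; \<open>vec\<close> and the outer
  restriction provide the extensionality that membership in the carriers demands.\<close>

lemma A_memI:
  assumes "\<And>v i k. v \<in> carrier V \<Longrightarrow> i \<in> {1..r} \<Longrightarrow> k \<in> {1..m i} \<Longrightarrow> F v i k \<in> carrier (T i)"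
    and "\<And>v w i k. v \<in> carrier V \<Longrightarrow> w \<in> carrier V \<Longrightarrow> i \<in> {1..r} \<Longrightarrow> k \<in> {1..m i} \<Longrightarrow>
      F (v \<oplus>\<^bsub>V\<^esub> w) i k = F v i k \<oplus>\<^bsub>T i\<^esub> F w i k"
    and "\<And>p v i k. p \<in> carrier P \<Longrightarrow> v \<in> carrier V \<Longrightarrow> i \<in> {1..r} \<Longrightarrow> k \<in> {1..m i} \<Longrightarrow>
      F (p \<odot>\<^bsub>V\<^esub> v) i k = p \<odot>\<^bsub>T i\<^esub> F v i k"
  shows "(\<lambda>v\<in>carrier V. vec (F v)) \<in> carrier A"
  unfolding A_carrier
proof (rule mod_homsI)
  have cl: "vec (F v) \<in> carrier V" if "v \<in> carrier V" for v
    using assms(1) that by (intro vec_closed) auto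
  then show "(\<lambda>v\<in>carrier V. vec (F v)) v \<in> carrier V" if "v \<in> carrier V" for v using that by simp
  show "(\<lambda>v\<in>carrier V. vec (F v)) (v \<oplus>\<^bsub>V\<^esub> w) =
      (\<lambda>v\<in>carrier V. vec (F v)) v \<oplus>\<^bsub>V\<^esub> (\<lambda>v\<in>carrier V. vec (F v)) w"
    if "v \<in> carrier V" "w \<in> carrier V" for v w
    by (rule V_eqI) (use that cl assms(2) in \<open>simp_all add: V_apply\<close>)
  show "(\<lambda>v\<in>carrier V. vec (F v)) (p \<odot>\<^bsub>V\<^esub> v) = p \<odot>\<^bsub>V\<^esub> (\<lambda>v\<in>carrier V. vec (F v)) v"
    if "p \<in> carrier P" "v \<in> carrier V" for p v
    by (rule V_eqI) (use that cl assms(3) V.smult_closed in \<open>simp_all add: V_apply\<close>)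
qed auto

text \<open>The matrix supported on the \<open>l\<close>th column of the \<open>(i,i)\<close> block,
  with entries \<open>p k\<close>. Matrix units, inverses in corner rings and the endomorphisms
  carrying one vector of \<open>D_j\<close> to another all have this shape.\<close>

definition column :: "nat \<Rightarrow> nat \<Rightarrow> (nat \<Rightarrow> 'e list) \<Rightarrow>
    (nat \<Rightarrow> nat \<Rightarrow> 'e list set) \<Rightarrow> nat \<Rightarrow> nat \<Rightarrow> 'e list set" where
  "column i l p = (\<lambda>v\<in>carrier V. vec (\<lambda>i' k. if i' = i then p k \<odot>\<^bsub>T i\<^esub> v i l else \<zero>\<^bsub>T i'\<^esub>))"

text \<open>The matrix unit in row \<open>k\<close> and column \<open>l\<close> of the
  \<open>(i,i)\<close> block. The off-diagonal ones serve to move between \<open>e_ik\<close> and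
  \<open>e_i1\<close>.\<close>

definition munit :: "nat \<Rightarrow> nat \<Rightarrow> nat \<Rightarrow>
    (nat \<Rightarrow> nat \<Rightarrow> 'e list set) \<Rightarrow> nat \<Rightarrow> nat \<Rightarrow> 'e list set" where
  "munit i k l = column i l (\<lambda>k'. if k' = k then \<one>\<^bsub>P\<^esub> else \<zero>\<^bsub>P\<^esub>)"

lemma column_closed:
  assumes il: "i \<in> {1..r}" "l \<in> {1..m i}" and p: "\<And>k. p k \<in> carrier P"
  shows "column i l p \<in> carrier A"
  unfolding column_def
proof (rule A_memI, goal_cases)
  case (1 v i' k)
  then show ?case using p V_entry[OF _ il] T.smult_closed by auto
next
  case (2 v w i' k)
  then show ?case using p V_entry[OF _ il] il by (auto simp: V_add T.smult_r_distr)
next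
  case (3 q v i' k)
  then show ?case using p V_entry[OF _ il] il
    by (auto simp: V_smult T.smult_assoc[symmetric] P.m_comm T.smult_r_null)
qed

lemma column_apply:
  assumes "v \<in> carrier V" "i' \<in> {1..r}" "k \<in> {1..m i'}"
  shows "column i l p v i' k = (if i' = i then p k \<odot>\<^bsub>T i\<^esub> v i l else \<zero>\<^bsub>T i'\<^esub>)"
  using assms by (simp add: column_def vec_apply)

lemma munit_closed: "i \<in> {1..r} \<Longrightarrow> l \<in> {1..m i} \<Longrightarrow> munit i k l \<in> carrier A"
  unfolding munit_def by (rule column_closed) auto

lemma munit_apply:
  assumes "v \<in> carrier V" "i \<in> {1..r}" "l \<in> {1..m i}" "i' \<in> {1..r}" "k' \<in> {1..m i'}"
  shows "munit i k l v i' k' = (if i' = i \<and> k' = k then v i l else \<zero>\<^bsub>T i'\<^esub>)"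
  using assms V_entry[OF assms(1-3)]
  by (simp add: munit_def column_apply T.smult_one T.smult_l_null)

lemma munit_mult:
  assumes "i \<in> {1..r}" "k \<in> {1..m i}" "l \<in> {1..m i}" "n \<in> {1..m i}"
  shows "munit i k l \<otimes>\<^bsub>A\<^esub> munit i l n = munit i k n"
proof (rule A_eqI)
  show "munit i k l \<otimes>\<^bsub>A\<^esub> munit i l n \<in> carrier A" "munit i k n \<in> carrier A"
    using munit_closed assms by auto
  show "(munit i k l \<otimes>\<^bsub>A\<^esub> munit i l n) v i' k' = munit i k n v i' k'"
    if "v \<in> carrier V" "i' \<in> {1..r}" "k' \<in> {1..m i'}" for v i' k'
    using that assms A_closed[OF munit_closed] by (simp add: A_apply munit_apply)
qed

lemma munit_eq_e_elem:
  assumes "i \<in> {1..r}" "k \<in> {1..m i}"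
  shows "e_elem E r lam m i k = munit i k k"
proof
  fix v show "e_elem E r lam m i k v = munit i k k v"
  proof (cases "v \<in> carrier V")
    case True
    have "e_elem E r lam m i k v =
        vec (\<lambda>i' k'. if i' = i \<and> k' = k then v i k else \<zero>\<^bsub>T i'\<^esub>)"
      using True unfolding e_elem_def vec_def summand_incl_def
      by (intro ext) (simp add: restrict_def isotypic_block_def direct_sum_simps)
    moreover have "\<dots> \<in> carrier V"
      using V_entry[OF True assms] by (intro vec_closed) auto
    ultimately show ?thesis
      using True assms A_closed[OF munit_closed[OF assms] True]
      by (intro V_eqI) (simp_all add: munit_apply vec_apply)
  next
    case False
    then show ?thesis by (simp add: e_elem_def munit_def column_def)
  qed
qed

text \<open>The decomposition of \<open>\<one>\<close> into the idempotents \<open>e_ik\<close>,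
  cast as an induction principle: additive statements about \<open>\<one>\<close> are reduced to
  single coordinates without writing a finite sum.\<close>

lemma one_induct [consumes 0, case_names zero add unit]:
  assumes "Q \<zero>\<^bsub>A\<^esub>"
    and "\<And>a b. a \<in> carrier A \<Longrightarrow> b \<in> carrier A \<Longrightarrow> Q a \<Longrightarrow> Q b \<Longrightarrow> Q (a \<oplus>\<^bsub>A\<^esub> b)"
    and "\<And>i k. i \<in> {1..r} \<Longrightarrow> k \<in> {1..m i} \<Longrightarrow> Q (munit i k k)"
  shows "Q \<one>\<^bsub>A\<^esub>"
proof -
  \<comment> \<open>The coordinate projection for \<open>S\<close> is the partial sum of the
    \<open>e_ik\<close> over \<open>S\<close>; it is zero for the empty set and
    \<open>\<one>\<close> for the full index set \<open>J\<close>.\<close>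
  define proj where "proj S = (\<lambda>v\<in>carrier V. vec (\<lambda>i k. if (i, k) \<in> S then v i k else \<zero>\<^bsub>T i\<^esub>))" for S
  have proj_apply: "proj S v i k = (if (i, k) \<in> S then v i k else \<zero>\<^bsub>T i\<^esub>)"
    if "v \<in> carrier V" "i \<in> {1..r}" "k \<in> {1..m i}" for S v i k
    using that by (simp add: proj_def vec_apply)
  have proj_closed: "proj S \<in> carrier A" for S
    unfolding proj_def
    by (rule A_memI) (auto simp: V_entry V_apply T.smult_r_null)
  define J where "J = (SIGMA i:{1..r}. {1..m i})"
  have "finite J" by (simp add: J_def)
  have proj_Q: "Q (proj S)" if "finite S" "S \<subseteq> J" for S using that
  proof (induction S rule: finite_induct)
    case empty
    have "proj {} = \<zero>\<^bsub>A\<^esub>"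
      by (rule A_eqI) (simp_all add: proj_closed proj_apply A_apply V_zero)
    then show ?case using assms(1) by simp
  next
    case (insert z S)
    obtain i k where z: "z = (i, k)" and ik: "i \<in> {1..r}" "k \<in> {1..m i}"
      using insert.prems by (auto simp: J_def)
    have "proj (insert z S) = munit i k k \<oplus>\<^bsub>A\<^esub> proj S"
    proof (rule A_eqI)
      show "munit i k k \<oplus>\<^bsub>A\<^esub> proj S \<in> carrier A" using munit_closed[OF ik] proj_closed by simp
      show "proj (insert z S) v i' k' = (munit i k k \<oplus>\<^bsub>A\<^esub> proj S) v i' k'"
        if "v \<in> carrier V" "i' \<in> {1..r}" "k' \<in> {1..m i'}" for v i' k'
        using that ik z insert.hyps V_entry[OF that]
        by (auto simp: proj_apply A_apply V_add munit_apply)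
    qed (rule proj_closed)
    then show ?case
      using assms(2)[OF munit_closed[OF ik] proj_closed assms(3)[OF ik]] insert by auto
  qed
  have "Q (proj J)" by (rule proj_Q[OF \<open>finite J\<close> order_refl])
  moreover have "proj J = \<one>\<^bsub>A\<^esub>"
    by (rule A_eqI) (auto simp: proj_closed proj_apply A_apply J_def)
  ultimately show ?thesis by simp
qed

section \<open>Coordinate inclusions and the matrix entries of an endomorphism\<close>

definition incl :: "nat \<Rightarrow> nat \<Rightarrow> 'e list set \<Rightarrow> nat \<Rightarrow> nat \<Rightarrow> 'e list set" where
  "incl i k x = vec (\<lambda>i' k'. if i' = i \<and> k' = k then x else \<zero>\<^bsub>T i'\<^esub>)"

lemma incl_closed: "x \<in> carrier (T i) \<Longrightarrow> incl i k x \<in> carrier V"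
  unfolding incl_def by (rule vec_closed) auto

lemma incl_apply:
  "i' \<in> {1..r} \<Longrightarrow> k' \<in> {1..m i'} \<Longrightarrow> incl i k x i' k' = (if i' = i \<and> k' = k then x else \<zero>\<^bsub>T i'\<^esub>)"
  by (simp add: incl_def vec_apply)

lemma incl_add:
  assumes "x \<in> carrier (T i)" "y \<in> carrier (T i)"
  shows "incl i k (x \<oplus>\<^bsub>T i\<^esub> y) = incl i k x \<oplus>\<^bsub>V\<^esub> incl i k y"
  by (rule V_eqI) (use assms in \<open>auto simp: incl_closed incl_apply V_add\<close>)

lemma incl_smult:
  assumes "p \<in> carrier P" "x \<in> carrier (T i)"
  shows "incl i k (p \<odot>\<^bsub>T i\<^esub> x) = p \<odot>\<^bsub>V\<^esub> incl i k x"
  by (rule V_eqI)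
    (use assms in \<open>auto simp: incl_closed incl_apply V_smult T.smult_closed V.smult_closed T.smult_r_null\<close>)

lemma incl_zero: "incl i k \<zero>\<^bsub>T i\<^esub> = \<zero>\<^bsub>V\<^esub>"
  by (rule V_eqI) (auto simp: incl_closed incl_apply V_zero)

lemma munit_diag_eq_incl:
  assumes "v \<in> carrier V" "i \<in> {1..r}" "k \<in> {1..m i}"
  shows "munit i k k v = incl i k (v i k)"
  by (rule V_eqI)
    (use assms A_closed[OF munit_closed[OF assms(2,3)]] V_entry[OF assms] in
      \<open>simp_all add: incl_closed incl_apply munit_apply\<close>)

text \<open>The target coordinate \<open>(j,l)\<close> comes first and the source coordinate
  \<open>(i,k)\<close> second, as row and column of a matrix.\<close>

definition entry where
  "entry a j l i k = (\<lambda>x\<in>carrier (T i). a (incl i k x) j l)"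

lemma entry_apply: "x \<in> carrier (T i) \<Longrightarrow> entry a j l i k x = a (incl i k x) j l"
  by (simp add: entry_def)

lemma entry_hom:
  assumes "a \<in> carrier A" "j \<in> {1..r}" "l \<in> {1..m j}"
  shows "entry a j l i k \<in> mod_homs P (T i) (T j)"
  by (rule mod_homsI)
    (use assms in \<open>simp_all add: entry_def V_entry A_closed incl_closed incl_add incl_smult A_add
      A_smult V_apply T.smult_closed\<close>)

text \<open>An element of this corner acts through a single entry, an endomorphism of
  \<open>E[t]/(t^n)\<close> with \<open>n = lam i\<close>. If its value at the generator is nonzero
  modulo \<open>t\<close>, some polynomial \<open>p\<close> carries that value back to the
  generator, and multiplication by \<open>p\<close> is the inverse.\<close>

lemma corner_unit:
  assumes ik: "i \<in> {1..r}" "k \<in> {1..m i}" and c: "c \<in> carrier A"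
    and corner: "munit i k k \<otimes>\<^bsub>A\<^esub> c \<otimes>\<^bsub>A\<^esub> munit i k k = c"
    and unit: "reduce E (entry c i k i k (gen (lam i))) \<noteq> \<zero>"
  shows "\<exists>c'\<in>carrier A. c' \<otimes>\<^bsub>A\<^esub> c = munit i k k \<and> c \<otimes>\<^bsub>A\<^esub> c' = munit i k k"
proof -
  let ?e = "munit i k k" and ?f = "entry c i k i k"
  have e: "?e \<in> carrier A" by (rule munit_closed[OF ik])
  note f = mod_homsD[OF entry_hom[OF c ik, of i k]]
  obtain p where p: "p \<in> carrier P" "p \<odot>\<^bsub>T i\<^esub> ?f (gen (lam i)) = gen (lam i)"
    using reduce_nonzero_generates[OF lam_pos[OF ik(1)] f(1)[OF gen_closed] unit] by blast
  define c' where "c' = column i k (\<lambda>k'. if k' = k then p else \<zero>\<^bsub>P\<^esub>)"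
  have c': "c' \<in> carrier A" unfolding c'_def by (rule column_closed[OF ik]) (use p in auto)
  have c'_apply: "c' v i' k' = (if i' = i \<and> k' = k then p \<odot>\<^bsub>T i\<^esub> v i k else \<zero>\<^bsub>T i'\<^esub>)"
    if "v \<in> carrier V" "i' \<in> {1..r}" "k' \<in> {1..m i'}" for v i' k'
    using that V_entry[OF that(1) ik] by (simp add: c'_def column_apply T.smult_l_null)
  have c_apply: "c v i' k' = (if i' = i \<and> k' = k then ?f (v i k) else \<zero>\<^bsub>T i'\<^esub>)"
    if v: "v \<in> carrier V" "i' \<in> {1..r}" "k' \<in> {1..m i'}" for v i' k'
  proof -
    have "c v = ?e (c (?e v))"
      using corner v(1) A_closed[OF e v(1)] by (metis A_apply(1))
    then show ?thesis
      using v ik A_closed[OF c A_closed[OF e v(1)]] V_entry[OF v(1) ik]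
      by (simp add: munit_apply munit_diag_eq_incl[OF v(1) ik] entry_apply)
  qed
  \<comment> \<open>Both maps are \<open>P\<close>-linear, so it is enough that they compose to the
    identity on the generator.\<close>
  have pf: "p \<odot>\<^bsub>T i\<^esub> ?f x = x" if x: "x \<in> carrier (T i)" for x
  proof -
    obtain q where q: "q \<in> carrier P" "x = q \<odot>\<^bsub>T i\<^esub> gen (lam i)" using trunc_cyclic[OF x] by metis
    have fg: "?f (gen (lam i)) \<in> carrier (T i)" using f(1) gen_closed by blast
    have "p \<odot>\<^bsub>T i\<^esub> ?f x = (p \<otimes>\<^bsub>P\<^esub> q) \<odot>\<^bsub>T i\<^esub> ?f (gen (lam i))"
      using p q fg f(4)[OF q(1) gen_closed] by (simp add: T.smult_assoc)
    also have "\<dots> = q \<odot>\<^bsub>T i\<^esub> (p \<odot>\<^bsub>T i\<^esub> ?f (gen (lam i)))"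
      using p(1) q(1) fg by (simp add: T.smult_assoc[symmetric] P.m_comm)
    finally show ?thesis using p q by simp
  qed
  have "c' \<otimes>\<^bsub>A\<^esub> c = ?e"
    by (rule A_eqI)
      (use c c' e ik in \<open>simp_all add: A_apply c'_apply c_apply A_closed munit_apply pf V_entry\<close>)
  \<comment> \<open>The entry commutes with multiplication by \<open>p\<close>, so the same identity
    \<open>pf\<close> settles the other order.\<close>
  moreover have "c \<otimes>\<^bsub>A\<^esub> c' = ?e"
    by (rule A_eqI)
      (use c c' e ik p(1) f(4) in \<open>simp_all add: A_apply c'_apply c_apply A_closed munit_apply pf V_entry\<close>)
  ultimately show ?thesis using c' by blast
qed

lemma gen_nonzero: "i \<in> {1..r} \<Longrightarrow> gen (lam i) \<noteq> \<zero>\<^bsub>T i\<^esub>"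
  using reduce_gen[OF lam_pos] reduce_zero[OF lam_pos] by (metis one_not_zero)

text \<open>If \<open>c + d = e\<close>, the reductions of their values at the generator add up to
  \<open>\<one>\<close>, so at least one is nonzero and \<open>corner_unit\<close> applies to
  it.\<close>

lemma munit_local_idem:
  assumes ik: "i \<in> {1..r}" "k \<in> {1..m i}"
  shows "local_idem A (munit i k k)"
  unfolding local_idem_def
proof (intro conjI ballI impI)
  let ?e = "munit i k k" and ?g = "gen (lam i)"
  show e: "?e \<in> carrier A" by (rule munit_closed[OF ik])
  show "?e \<otimes>\<^bsub>A\<^esub> ?e = ?e" using munit_mult ik by blast
  have g: "incl i k ?g \<in> carrier V" by (rule incl_closed[OF gen_closed])
  have eg: "?e (incl i k ?g) i k = ?g" using g ik by (simp add: munit_apply incl_apply)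
  show "?e \<noteq> \<zero>\<^bsub>A\<^esub>"
  proof
    assume "?e = \<zero>\<^bsub>A\<^esub>"
    then have "?e (incl i k ?g) i k = \<zero>\<^bsub>T i\<^esub>" by (simp only: A_apply(4)[OF g] V_zero[OF ik])
    then show False using eg gen_nonzero[OF ik(1)] by simp
  qed
  fix c d assume c: "c \<in> carrier A" and d: "d \<in> carrier A"
    and ec: "?e \<otimes>\<^bsub>A\<^esub> c \<otimes>\<^bsub>A\<^esub> ?e = c" and ed: "?e \<otimes>\<^bsub>A\<^esub> d \<otimes>\<^bsub>A\<^esub> ?e = d" and cd: "c \<oplus>\<^bsub>A\<^esub> d = ?e"
  note closed = mod_homsD(1)[OF entry_hom[OF c ik, of i k] gen_closed]
    mod_homsD(1)[OF entry_hom[OF d ik, of i k] gen_closed]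
  have "entry c i k i k ?g \<oplus>\<^bsub>T i\<^esub> entry d i k i k ?g = (c \<oplus>\<^bsub>A\<^esub> d) (incl i k ?g) i k"
    by (simp only: entry_apply[OF gen_closed] A_apply(2)[OF g] V_add[OF ik])
  then have "entry c i k i k ?g \<oplus>\<^bsub>T i\<^esub> entry d i k i k ?g = ?g"
    by (simp only: cd eg)
  then have "reduce E (entry c i k i k ?g) \<oplus> reduce E (entry d i k i k ?g) = \<one>"
    by (simp only: reduce_add[OF lam_pos[OF ik(1)] closed, symmetric] reduce_gen[OF lam_pos[OF ik(1)]])
  then have "reduce E (entry c i k i k ?g) \<noteq> \<zero> \<or> reduce E (entry d i k i k ?g) \<noteq> \<zero>"
    by auto
  then show "(\<exists>c'\<in>carrier A. c' \<otimes>\<^bsub>A\<^esub> c = ?e \<and> c \<otimes>\<^bsub>A\<^esub> c' = ?e) \<or>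
      (\<exists>d'\<in>carrier A. d' \<otimes>\<^bsub>A\<^esub> d = ?e \<and> d \<otimes>\<^bsub>A\<^esub> d' = ?e)"
    using corner_unit[OF ik c ec] corner_unit[OF ik d ed] by blast
qed


subsection \<open>The simple modules\<close>

declare One_nat_def [simp del]

abbreviation "rv j \<equiv> reduce_vec E (m j)"

text \<open>The inclusion of the \<open>j\<close>th block written through \<open>vec\<close>, so
  that coordinate lemmas apply; on the carrier of the block it agrees with
  \<open>summand_incl\<close>.\<close>

definition bincl :: "nat \<Rightarrow> (nat \<Rightarrow> 'e list set) \<Rightarrow> nat \<Rightarrow> nat \<Rightarrow> 'e list set" where
  "bincl j x = vec (\<lambda>i k. if i = j then x k else \<zero>\<^bsub>T i\<^esub>)"

lemma summand_incl_eq_bincl: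
  assumes "x \<in> carrier (B j)"
  shows "summand_incl {1..r} B j x = bincl j x"
proof -
  have "(\<lambda>k\<in>{1..m j}. x k) = x" using assms by (simp add: B_carrier PiE_restrict)
  then show ?thesis
    unfolding summand_incl_def bincl_def vec_def isotypic_block_def direct_sum_simps
    by (intro restrict_ext) simp
qed

lemma bincl_closed: "x \<in> carrier (B j) \<Longrightarrow> bincl j x \<in> carrier V"
  unfolding bincl_def by (rule vec_closed) (auto simp: B_component)

lemma bincl_apply:
  "i \<in> {1..r} \<Longrightarrow> k \<in> {1..m i} \<Longrightarrow> bincl j x i k = (if i = j then x k else \<zero>\<^bsub>T i\<^esub>)"
  by (simp add: bincl_def vec_apply)

lemma B_add: "k \<in> {1..m i} \<Longrightarrow> (x \<oplus>\<^bsub>B i\<^esub> y) k = x k \<oplus>\<^bsub>T i\<^esub> y k"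
  by (simp add: isotypic_block_def direct_sum_simps)

lemma bincl_add:
  assumes "x \<in> carrier (B j)" "y \<in> carrier (B j)"
  shows "bincl j (x \<oplus>\<^bsub>B j\<^esub> y) = bincl j x \<oplus>\<^bsub>V\<^esub> bincl j y"
  by (rule V_eqI) (use assms in \<open>auto simp: bincl_closed bincl_apply V_add B_add\<close>)

lemma munit_bincl:
  assumes "i \<in> {1..r}" "k \<in> {1..m i}" "x \<in> carrier (B j)"
  shows "munit i k k (bincl j x) = (if i = j then incl j k (x k) else \<zero>\<^bsub>V\<^esub>)"
  using assms by (simp add: munit_diag_eq_incl bincl_closed bincl_apply incl_zero)

lemma reduce_V_add:
  assumes "v \<in> carrier V" "w \<in> carrier V" "j \<in> {1..r}" "l \<in> {1..m j}"
  shows "reduce E ((v \<oplus>\<^bsub>V\<^esub> w) j l) = reduce E (v j l) \<oplus> reduce E (w j l)"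
  by (simp only: V_add[OF assms(3,4)] reduce_add[OF lam_pos[OF assms(3)] V_entry[OF assms(1,3,4)] V_entry[OF assms(2,3,4)]])

lemma reduce_V_zero: "j \<in> {1..r} \<Longrightarrow> l \<in> {1..m j} \<Longrightarrow> reduce E (\<zero>\<^bsub>V\<^esub> j l) = \<zero>"
  by (simp only: V_zero reduce_zero[OF lam_pos])

text \<open>This makes the induced action on \<open>D_j\<close> well defined. Coordinate by
  coordinate, an entry within the block acts modulo \<open>t\<close> as a scalar and so sees only
  the reduction of its argument.\<close>

lemma reduce_action_cong:
  assumes a: "a \<in> carrier A" and jl: "j \<in> {1..r}" "l \<in> {1..m j}"
    and x: "x \<in> carrier (B j)" and y: "y \<in> carrier (B j)"
    and xy: "\<And>k. k \<in> {1..m j} \<Longrightarrow> reduce E (x k) = reduce E (y k)"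
  shows "reduce E (a (bincl j x) j l) = reduce E (a (bincl j y) j l)"
proof -
  note bx = bincl_closed[OF x] and bv = bincl_closed[OF y]
  \<comment> \<open>The identity is inserted so that \<open>one_induct\<close> can split the
    argument into its coordinates.\<close>
  have "reduce E (a (\<one>\<^bsub>A\<^esub> (bincl j x)) j l) = reduce E (a (\<one>\<^bsub>A\<^esub> (bincl j y)) j l)"
  proof (induction rule: one_induct)
    case zero
    show ?case by (simp only: A_apply(4)[OF bx] A_apply(4)[OF bv])
  next
    case (add c d)
    then show ?case
      by (simp only: A_apply(2)[OF bx] A_apply(2)[OF bv] A_add[OF a] A_closed[OF add(1) bx] A_closed[OF add(2) bx]
          A_closed[OF add(1) bv] A_closed[OF add(2) bv] A_closed[OF a] reduce_V_add[OF _ _ jl])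
  next
    case (unit i k)
    show ?case
    proof (cases "i = j")
      case True
      with unit have k: "k \<in> {1..m j}" by simp
      note h = reduce_hom[OF lam_pos[OF jl(1)] entry_hom[OF a jl, of j k]]
      have "reduce E (a (incl j k (x k)) j l) = reduce E (a (incl j k (y k)) j l)"
        using h[OF B_component[OF x k]] h[OF B_component[OF y k]] xy[OF k]
        by (simp only: entry_apply[OF B_component[OF x k]] entry_apply[OF B_component[OF y k]])
      then show ?thesis using munit_bincl[OF unit x] munit_bincl[OF unit y] True by simp
    next
      case False
      then show ?thesis by (simp only: munit_bincl[OF unit x] munit_bincl[OF unit y] if_False)
    qed
  qed
  then show ?thesis by (simp only: A_apply(3)[OF bx] A_apply(3)[OF bv])
qed

text \<open>The composites through the blocks other than \<open>j\<close> vanish modulo \<open>t\<close>.\<close>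

lemma reduce_action_mult:
  assumes a: "a \<in> carrier A" and b: "b \<in> carrier A" and jl: "j \<in> {1..r}" "l \<in> {1..m j}"
    and x: "x \<in> carrier (B j)"
  shows "reduce E (a (b (bincl j x)) j l) = reduce E (a (bincl j (b (bincl j x) j)) j l)"
proof -
  let ?u = "b (bincl j x)"
  note bx = bincl_closed[OF x]
  have u: "?u \<in> carrier V" using A_closed[OF b bx] .
  have uj: "?u j \<in> carrier (B j)" using V_component[OF u jl(1)] .
  note bu = bincl_closed[OF uj]
  \<comment> \<open>The contribution of a coordinate outside block \<open>j\<close>. Splitting
    \<open>x\<close> into coordinates as well turns it into composites of two entries, from block
    \<open>j\<close> to block \<open>i\<close> and back.\<close>
  have other: "reduce E (a (incl i k (?u i k)) j l) = \<zero>"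
    if ik: "i \<in> {1..r}" "k \<in> {1..m i}" and ij: "i \<noteq> j" for i k
  proof -
    have "reduce E (a (incl i k (b (\<one>\<^bsub>A\<^esub> (bincl j x)) i k)) j l) = \<zero>"
    proof (induction rule: one_induct)
      case zero
      show ?case
        by (simp only: A_apply(4)[OF bx] A_zero[OF b] V_zero[OF ik] incl_zero A_zero[OF a] reduce_V_zero[OF jl])
    next
      case (add c d)
      have cd: "b (c (bincl j x)) \<in> carrier V" "b (d (bincl j x)) \<in> carrier V"
        using A_closed[OF b A_closed[OF add(1) bx]] A_closed[OF b A_closed[OF add(2) bx]] .
      note cd' = V_entry[OF cd(1) ik] V_entry[OF cd(2) ik]
      show ?case
        by (simp only: A_apply(2)[OF bx] A_add[OF b] A_closed[OF add(1) bx] A_closed[OF add(2) bx]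
            V_add[OF ik] incl_add[OF cd'] A_add[OF a incl_closed[OF cd'(1)] incl_closed[OF cd'(2)]]
            reduce_V_add[OF A_closed[OF a incl_closed[OF cd'(1)]] A_closed[OF a incl_closed[OF cd'(2)]] jl]
            add(3,4)) simp
    next
      case (unit i' k')
      show ?case
      proof (cases "i' = j")
        case True
        with unit have k': "k' \<in> {1..m j}" by simp
        note xk = B_component[OF x k']
        note f = entry_hom[OF b ik, of j k'] and g = entry_hom[OF a jl, of i k]
        have "reduce E (entry a j l i k (entry b i k j k' (x k'))) = \<zero>"
          by (rule reduce_hom_hom[OF lam_pos[OF jl(1)] lam_pos[OF ik(1)] _ f g xk])
            (use lam_neq[OF ik(1) jl(1) ij] in simp)
        moreover have "entry a j l i k (entry b i k j k' (x k')) = a (incl i k (b (incl j k' (x k')) i k)) j l"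
          using entry_apply[OF mod_homsD(1)[OF f xk], of a j l k] entry_apply[OF xk, of b i k k'] by simp
        ultimately show ?thesis using munit_bincl[OF unit x] True by simp
      next
        case False
        then show ?thesis
          by (simp only: munit_bincl[OF unit x] if_False A_zero[OF b] V_zero[OF ik] incl_zero A_zero[OF a]
              reduce_V_zero[OF jl])
      qed
    qed
    then show ?thesis by (simp only: A_apply(3)[OF bx])
  qed
  \<comment> \<open>Now the intermediate vector is split: coordinates in block \<open>j\<close>
    agree on both sides, and the others vanish modulo \<open>t\<close> on the left and are zero on
    the right.\<close>
  have "reduce E (a (\<one>\<^bsub>A\<^esub> ?u) j l) = reduce E (a (\<one>\<^bsub>A\<^esub> (bincl j (?u j))) j l)"
  proof (induction rule: one_induct)
    case zero
    show ?case by (simp only: A_apply(4)[OF u] A_apply(4)[OF bu])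
  next
    case (add c d)
    then show ?case
      by (simp only: A_apply(2)[OF u] A_apply(2)[OF bu] A_add[OF a] A_closed[OF add(1) u] A_closed[OF add(2) u]
          A_closed[OF add(1) bu] A_closed[OF add(2) bu] A_closed[OF a] reduce_V_add[OF _ _ jl])
  next
    case (unit i k)
    show ?case
    proof (cases "i = j")
      case True
      then show ?thesis using munit_bincl[OF unit uj] munit_diag_eq_incl[OF u unit] by simp
    next
      case False
      then show ?thesis
        by (simp only: munit_bincl[OF unit uj] munit_diag_eq_incl[OF u unit] if_False A_zero[OF a]
            reduce_V_zero[OF jl] other[OF unit False])
    qed
  qed
  then show ?thesis by (simp only: A_apply(3)[OF u] A_apply(3)[OF bu])
qed

section \<open>The modules \<open>D_j\<close> in coordinates\<close>

lemma D_carrier: "carrier (D j) = (\<Pi>\<^sub>E k\<in>{1..m j}. carrier E)"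
  by (simp add: D_module_def coord_space_def direct_sum_simps)

lemma D_add: "k \<in> {1..m j} \<Longrightarrow> (w \<oplus>\<^bsub>D j\<^esub> w') k = w k \<oplus> w' k"
  and D_zero: "k \<in> {1..m j} \<Longrightarrow> \<zero>\<^bsub>D j\<^esub> k = \<zero>"
  by (simp_all add: D_module_def coord_space_def direct_sum_simps)

lemma D_component: "w \<in> carrier (D j) \<Longrightarrow> k \<in> {1..m j} \<Longrightarrow> w k \<in> carrier E"
  unfolding D_carrier by blast

lemma D_eqI:
  assumes "v \<in> carrier (D j)" "w \<in> carrier (D j)" "\<And>k. k \<in> {1..m j} \<Longrightarrow> v k = w k"
  shows "v = w"
  by (rule PiE_ext[of _ "{1..m j}" "\<lambda>_. carrier E"]) (use assms in \<open>simp_all add: D_carrier\<close>)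

lemma D_add_closed: "w \<in> carrier (D j) \<Longrightarrow> w' \<in> carrier (D j) \<Longrightarrow> w \<oplus>\<^bsub>D j\<^esub> w' \<in> carrier (D j)"
  and D_zero_closed: "\<zero>\<^bsub>D j\<^esub> \<in> carrier (D j)"
  unfolding D_carrier by (auto simp: D_module_def coord_space_def direct_sum_simps)

lemma rv_apply: "k \<in> {1..m j} \<Longrightarrow> rv j x k = reduce E (x k)"
  by (simp add: reduce_vec_def)

lemma rv_closed:
  assumes "j \<in> {1..r}" "x \<in> carrier (B j)"
  shows "rv j x \<in> carrier (D j)"
  unfolding D_carrier reduce_vec_def
  by (intro restrict_PiE_iff[THEN iffD2] ballI)
    (rule reduce_closed[OF lam_pos[OF assms(1)] B_component[OF assms(2)]])

text \<open>A section of the reduction map, by constant polynomials. It supplies a representative on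
  which the action on \<open>D_j\<close> can be computed.\<close>

definition lift :: "nat \<Rightarrow> (nat \<Rightarrow> 'e) \<Rightarrow> nat \<Rightarrow> 'e list set" where
  "lift j w = (\<lambda>k\<in>{1..m j}. poly_of_const (w k) \<odot>\<^bsub>T j\<^esub> gen (lam j))"

lemma lift_closed:
  assumes "w \<in> carrier (D j)" shows "lift j w \<in> carrier (B j)"
  unfolding B_carrier lift_def
  by (intro restrict_PiE_iff[THEN iffD2] ballI)
    (intro T.smult_closed const_closed D_component[OF assms] gen_closed)

lemma rv_lift:
  assumes j: "j \<in> {1..r}" and w: "w \<in> carrier (D j)"
  shows "rv j (lift j w) = w"
proof (rule D_eqI[OF rv_closed[OF j lift_closed[OF w]] w])
  fix k assume k: "k \<in> {1..m j}"
  note wk = D_component[OF w k]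
  have "reduce E (poly_of_const (w k) \<odot>\<^bsub>T j\<^esub> gen (lam j)) = w k"
    using wk by (simp add: reduce_smult[OF lam_pos[OF j] const_closed[OF wk] gen_closed]
      reduce_gen[OF lam_pos[OF j]] const_term_const)
  then show "rv j (lift j w) k = w k" using k by (simp add: rv_apply lift_def)
qed

text \<open>By \<open>reduce_action_cong\<close> the set under \<open>the_elem\<close> in
  \<open>reduce_endo\<close> is a singleton, so the action may be computed from any representative
  \<open>x\<close>.\<close>

lemma D_smult:
  assumes a: "a \<in> carrier A" and j: "j \<in> {1..r}" and x: "x \<in> carrier (B j)"
  shows "a \<odot>\<^bsub>D j\<^esub> rv j x = rv j (a (bincl j x) j)"
proof -
  let ?f = "block_entry {1..r} B a j j"
  let ?S = "{v \<in> carrier (B j). rv j v = rv j x}"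
  have D_eq: "carrier (coord_space E (m j)) = carrier (D j)" by (simp add: D_module_def)
  have f: "?f v = a (bincl j v) j" if "v \<in> carrier (B j)" for v
    using that by (simp add: block_entry_def summand_incl_eq_bincl)
  have const: "rv j (?f v) = rv j (a (bincl j x) j)" if v: "v \<in> ?S" for v
  proof -
    have vB: "v \<in> carrier (B j)" using v by simp
    have eq: "reduce E (v k) = reduce E (x k)" if "k \<in> {1..m j}" for k
      using v that rv_apply[OF that, of v] rv_apply[OF that, of x] by simp
    have "rv j (a (bincl j v) j) = rv j (a (bincl j x) j)"
      unfolding reduce_vec_def
      by (rule restrict_ext) (rule reduce_action_cong[OF a j _ vB x eq])
    then show ?thesis using f[OF vB] by simp
  qed
  have xS: "x \<in> ?S" using x by simp
  have "rv j ` ?f ` ?S = {rv j (a (bincl j x) j)}"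
  proof (intro subset_antisym subsetI)
    fix y assume "y \<in> rv j ` ?f ` ?S"
    then show "y \<in> {rv j (a (bincl j x) j)}"
      by (elim imageE) (simp only: const singleton_iff)
  next
    fix y assume "y \<in> {rv j (a (bincl j x) j)}"
    then have "y = rv j (?f x)" by (simp only: const[OF xS] singleton_iff)
    then show "y \<in> rv j ` ?f ` ?S" using xS by (blast intro: imageI)
  qed
  moreover have "a \<odot>\<^bsub>D j\<^esub> w = reduce_endo E (lam j) (m j) ?f w" for w
    by (simp add: D_module_def)
  ultimately show ?thesis
    using rv_closed[OF j x] by (simp add: reduce_endo_def D_eq)
qed

lemma D_smult_apply:
  assumes "a \<in> carrier A" "j \<in> {1..r}" "w \<in> carrier (D j)" "k \<in> {1..m j}"
  shows "(a \<odot>\<^bsub>D j\<^esub> w) k = reduce E (a (bincl j (lift j w)) j k)"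
  using D_smult[OF assms(1,2) lift_closed[OF assms(3)]] rv_lift[OF assms(2,3)] rv_apply[OF assms(4)]
  by simp

lemma D_smult_closed:
  assumes "a \<in> carrier A" "j \<in> {1..r}" "w \<in> carrier (D j)"
  shows "a \<odot>\<^bsub>D j\<^esub> w \<in> carrier (D j)"
proof -
  note x = lift_closed[OF assms(3)]
  have "a \<odot>\<^bsub>D j\<^esub> w = rv j (a (bincl j (lift j w)) j)"
    using D_smult[OF assms(1,2) x] by (simp only: rv_lift[OF assms(2,3)])
  then show ?thesis
    using rv_closed[OF assms(2) V_component[OF A_closed[OF assms(1) bincl_closed[OF x]] assms(2)]] by (simp only:)
qed

lemma D_left_module:
  assumes j: "j \<in> {1..r}"
  shows "left_module A (D j)"
proof (rule left_moduleI[OF A.ring_axioms], goal_cases)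
  case (1 x y)
  then show ?case by (rule D_add_closed)
next
  case 2
  show ?case by (rule D_zero_closed)
next
  case (3 x y z)
  then show ?case
    by (intro D_eqI[of _ j] D_add_closed) (simp_all add: D_add D_component a_assoc)
next
  case (4 x y)
  then show ?case
    by (intro D_eqI[of _ j] D_add_closed) (simp_all add: D_add D_component a_comm)
next
  case (5 x)
  then show ?case
    by (intro D_eqI[of _ j] D_add_closed D_zero_closed) (simp_all add: D_add D_zero D_component)
next
  case (6 a x)
  then show ?case using D_smult_closed[OF _ j] by blast
next
  case (7 a b w)
  note bl = bincl_closed[OF lift_closed[OF 7(3)]]
  show ?case
  proof (rule D_eqI[of _ j])
    show "(a \<oplus>\<^bsub>A\<^esub> b) \<odot>\<^bsub>D j\<^esub> w \<in> carrier (D j)" "a \<odot>\<^bsub>D j\<^esub> w \<oplus>\<^bsub>D j\<^esub> b \<odot>\<^bsub>D j\<^esub> w \<in> carrier (D j)"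
      using 7 by (auto intro!: D_add_closed D_smult_closed j)
    fix k assume k: "k \<in> {1..m j}"
    show "((a \<oplus>\<^bsub>A\<^esub> b) \<odot>\<^bsub>D j\<^esub> w) k = (a \<odot>\<^bsub>D j\<^esub> w \<oplus>\<^bsub>D j\<^esub> b \<odot>\<^bsub>D j\<^esub> w) k"
      by (simp only: D_add[OF k] D_smult_apply[OF _ j _ k] 7 A.add.m_closed A_apply(2)[OF bl]
          reduce_V_add[OF A_closed[OF 7(1) bl] A_closed[OF 7(2) bl] j k])
  qed
next
  case (8 a w w')
  let ?x = "lift j w" and ?y = "lift j w'"
  note x = lift_closed[OF 8(2)] and y = lift_closed[OF 8(3)]
  note bx = bincl_closed[OF x] and bv = bincl_closed[OF y]
  have xy: "?x \<oplus>\<^bsub>B j\<^esub> ?y \<in> carrier (B j)" using x y by simp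
  \<comment> \<open>\<open>D_smult\<close> accepts any representative, so the sum of the two lifts
    can stand for \<open>w + w'\<close>.\<close>
  have sum: "w \<oplus>\<^bsub>D j\<^esub> w' = rv j (?x \<oplus>\<^bsub>B j\<^esub> ?y)"
  proof (rule D_eqI[OF D_add_closed[OF 8(2,3)] rv_closed[OF j xy]])
    fix k assume k: "k \<in> {1..m j}"
    have "rv j ?x k = w k" "rv j ?y k = w' k" using rv_lift[OF j] 8 by simp_all
    then show "(w \<oplus>\<^bsub>D j\<^esub> w') k = rv j (?x \<oplus>\<^bsub>B j\<^esub> ?y) k"
      by (simp only: D_add[OF k] rv_apply[OF k] B_add[OF k]
          reduce_add[OF lam_pos[OF j] B_component[OF x k] B_component[OF y k]])
  qed
  show ?case
  proof (rule D_eqI[of _ j])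
    show "a \<odot>\<^bsub>D j\<^esub> (w \<oplus>\<^bsub>D j\<^esub> w') \<in> carrier (D j)" "a \<odot>\<^bsub>D j\<^esub> w \<oplus>\<^bsub>D j\<^esub> a \<odot>\<^bsub>D j\<^esub> w' \<in> carrier (D j)"
      using 8 by (auto intro!: D_add_closed D_smult_closed j)
    fix k assume k: "k \<in> {1..m j}"
    show "(a \<odot>\<^bsub>D j\<^esub> (w \<oplus>\<^bsub>D j\<^esub> w')) k = (a \<odot>\<^bsub>D j\<^esub> w \<oplus>\<^bsub>D j\<^esub> a \<odot>\<^bsub>D j\<^esub> w') k"
      by (simp only: sum D_smult[OF 8(1) j xy] rv_apply[OF k] D_add[OF k] D_smult_apply[OF 8(1) j _ k] 8(2,3)
          bincl_add[OF x y] A_add[OF 8(1) bx bv] reduce_V_add[OF A_closed[OF 8(1) bx] A_closed[OF 8(1) bv] j k])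
  qed
next
  \<comment> \<open>The product of matrices has contributions to the \<open>(j,j)\<close> block from
    all other blocks; \<open>reduce_action_mult\<close> discards them.\<close>
  case (9 a b w)
  let ?x = "lift j w"
  note x = lift_closed[OF 9(3)]
  note bx = bincl_closed[OF x]
  note bbx = V_component[OF A_closed[OF 9(2) bx] j]
  have ab: "a \<otimes>\<^bsub>A\<^esub> b \<in> carrier A" using 9 by simp
  show ?case
  proof (rule D_eqI[of _ j])
    show "(a \<otimes>\<^bsub>A\<^esub> b) \<odot>\<^bsub>D j\<^esub> w \<in> carrier (D j)" "a \<odot>\<^bsub>D j\<^esub> (b \<odot>\<^bsub>D j\<^esub> w) \<in> carrier (D j)"
      using 9 ab by (auto intro!: D_smult_closed j)
    fix k assume k: "k \<in> {1..m j}"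
    have bw: "b \<odot>\<^bsub>D j\<^esub> w = rv j (b (bincl j ?x) j)"
      using D_smult[OF 9(2) j x] rv_lift[OF j 9(3)] by simp
    show "((a \<otimes>\<^bsub>A\<^esub> b) \<odot>\<^bsub>D j\<^esub> w) k = (a \<odot>\<^bsub>D j\<^esub> (b \<odot>\<^bsub>D j\<^esub> w)) k"
      by (simp only: bw D_smult[OF 9(1) j bbx] rv_apply[OF k] D_smult_apply[OF ab j 9(3) k] A_apply(1)[OF bx]
          reduce_action_mult[OF 9(1,2) j k x])
  qed
next
  case (10 w)
  note x = lift_closed[OF 10]
  have "\<one>\<^bsub>A\<^esub> \<odot>\<^bsub>D j\<^esub> w = rv j (bincl j (lift j w) j)"
    using D_smult[OF A.one_closed j x] rv_lift[OF j 10] A_apply(3)[OF bincl_closed[OF x]] by simp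
  also have "bincl j (lift j w) j = lift j w"
    by (rule B_eqI[OF V_component[OF bincl_closed[OF x] j] x]) (simp add: bincl_apply[OF j])
  finally show ?case using rv_lift[OF j 10] by simp
next
  case (11 w)
  note bx = bincl_closed[OF lift_closed[OF 11]]
  show ?case
    by (rule D_eqI[OF D_smult_closed[OF A.zero_closed j 11] D_zero_closed])
      (simp only: D_smult_apply[OF A.zero_closed j 11] A_apply(4)[OF bx] reduce_V_zero[OF j] D_zero)
qed

section \<open>Simplicity of the \<open>D_j\<close> and their \<open>E\<close>-vector space
  structure\<close>

lemma D_column:
  assumes i: "i \<in> {1..r}" and l: "l \<in> {1..m i}" and p: "\<And>k. p k \<in> carrier P"
    and j: "j \<in> {1..r}" and w: "w \<in> carrier (D j)" and k: "k \<in> {1..m j}"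
  shows "(column i l p \<odot>\<^bsub>D j\<^esub> w) k = (if j = i then const_term (p k) \<otimes> w l else \<zero>)"
proof -
  note x = lift_closed[OF w]
  note bx = bincl_closed[OF x]
  have "(column i l p \<odot>\<^bsub>D j\<^esub> w) k = reduce E (column i l p (bincl j (lift j w)) j k)"
    by (rule D_smult_apply[OF column_closed[OF i l p] j w k])
  also have "\<dots> = (if j = i then const_term (p k) \<otimes> w l else \<zero>)"
  proof (cases "j = i")
    case True
    then have lj: "l \<in> {1..m j}" using l by simp
    have "column i l p (bincl j (lift j w)) j k = p k \<odot>\<^bsub>T j\<^esub> lift j w l"
      using column_apply[OF bx j k, of i l p] bincl_apply[OF j lj, of j "lift j w"] True by simp
    moreover have "reduce E (lift j w l) = w l" using rv_apply[OF lj] rv_lift[OF j w] by metis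
    ultimately show ?thesis
      using reduce_smult[OF lam_pos[OF j] p[of k] B_component[OF x lj]] True by simp
  next
    case False
    then show ?thesis by (simp add: column_apply[OF bx j k] reduce_zero[OF lam_pos[OF j]])
  qed
  finally show ?thesis .
qed

lemma D_munit:
  assumes i: "i \<in> {1..r}" and l: "l \<in> {1..m i}" and j: "j \<in> {1..r}" and w: "w \<in> carrier (D j)"
    and k': "k' \<in> {1..m j}"
  shows "(munit i k l \<odot>\<^bsub>D j\<^esub> w) k' = (if j = i \<and> k' = k then w l else \<zero>)"
proof -
  let ?p = "\<lambda>k'. if k' = k then \<one>\<^bsub>P\<^esub> else \<zero>\<^bsub>P\<^esub>"
  have p: "?p k \<in> carrier P" for k by simp
  show ?thesis
    unfolding munit_def D_column[OF i l p j w k']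
    using D_component[OF w] l by (auto simp: const_term_one const_term_zero_poly)
qed

text \<open>A vector \<open>w\<close> with \<open>w l\<close> nonzero is sent to any prescribed
  \<open>u\<close> by the column matrix with entries \<open>u k / w l\<close>.\<close>

lemma D_simple:
  assumes j: "j \<in> {1..r}"
  shows "simple_module A (D j)"
  unfolding simple_module_def
proof (intro conjI allI impI)
  show "left_module A (D j)" by (rule D_left_module[OF j])
  have one: "(\<lambda>k\<in>{1..m j}. \<one>) \<in> carrier (D j)" by (simp add: D_carrier)
  have "(\<lambda>k\<in>{1..m j}. \<one>) \<noteq> \<zero>\<^bsub>D j\<^esub>"
    using D_zero[OF one_in_range[OF j]] one_in_range[OF j] by (metis one_not_zero restrict_apply')
  with one show "carrier (D j) \<noteq> {\<zero>\<^bsub>D j\<^esub>}" by blast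
  fix N assume "submodule N A (D j)"
  note N = submoduleD[OF this]
  show "N = {\<zero>\<^bsub>D j\<^esub>} \<or> N = carrier (D j)"
  proof (cases "N = {\<zero>\<^bsub>D j\<^esub>}")
    case False
    then obtain w where w: "w \<in> N" "w \<noteq> \<zero>\<^bsub>D j\<^esub>" using N(2) by blast
    have wD: "w \<in> carrier (D j)" using w N(1) by blast
    obtain l where l: "l \<in> {1..m j}" "w l \<noteq> \<zero>"
      using D_eqI[OF wD D_zero_closed] w(2) D_zero by metis
    note wl = D_component[OF wD l(1)]
    have "u \<in> N" if u: "u \<in> carrier (D j)" for u
    proof -
      \<comment> \<open>The value zero outside the index range keeps \<open>p k\<close> a polynomial
        for every \<open>k\<close>, as \<open>column_closed\<close> requires.\<close>
      define p where "p k = (if k \<in> {1..m j} then poly_of_const (u k \<otimes> inv (w l)) else \<zero>\<^bsub>P\<^esub>)" for k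
      have invw: "inv (w l) \<in> carrier E" "inv (w l) \<otimes> w l = \<one>"
        using wl l(2) by (auto simp: field_Units)
      have p: "p k \<in> carrier P" for k
        unfolding p_def using D_component[OF u] invw by (auto intro!: const_closed)
      have cl: "column j l p \<in> carrier A" by (rule column_closed[OF j l(1) p])
      have "column j l p \<odot>\<^bsub>D j\<^esub> w = u"
      proof (rule D_eqI[OF D_smult_closed[OF cl j wD] u])
        fix k assume k: "k \<in> {1..m j}"
        have "(column j l p \<odot>\<^bsub>D j\<^esub> w) k = const_term (p k) \<otimes> w l"
          using D_column[OF j l(1) p j wD k] by simp
        also have "\<dots> = u k"
          using k D_component[OF u k] invw wl by (simp add: p_def const_term_const m_assoc)
        finally show "(column j l p \<odot>\<^bsub>D j\<^esub> w) k = u k" .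
      qed
      then show ?thesis using N(4)[OF cl w(1)] by simp
    qed
    then show ?thesis using N(1) by blast
  qed simp
qed

lemma scalar_action:
  assumes c: "c \<in> carrier E" and j: "j \<in> {1..r}" and w: "w \<in> carrier (D j)"
  shows "scalar_endo E r lam m c \<in> carrier A"
    and "scalar_endo E r lam m c \<odot>\<^bsub>D j\<^esub> w = c \<odot>\<^bsub>coord_space E (m j)\<^esub> w"
proof -
  let ?s = "scalar_endo E r lam m c"
  note pc = const_closed[OF c]
  show s: "?s \<in> carrier A"
    unfolding A_carrier
    by (rule mod_homsI)
      (use pc in \<open>simp_all add: scalar_endo_def V.smult_closed V.smult_r_distr V.smult_assoc[symmetric] P.m_comm\<close>)
  have cs: "(c \<odot>\<^bsub>coord_space E (m j)\<^esub> w) k = c \<otimes> w k" if "k \<in> {1..m j}" for k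
    using that by (simp add: coord_space_def direct_sum_simps)
  have "c \<odot>\<^bsub>coord_space E (m j)\<^esub> w \<in> carrier (D j)"
    using c w by (auto simp: D_carrier coord_space_def direct_sum_simps)
  then show "?s \<odot>\<^bsub>D j\<^esub> w = c \<odot>\<^bsub>coord_space E (m j)\<^esub> w"
  proof (rule D_eqI[OF D_smult_closed[OF s j w]])
    fix k assume k: "k \<in> {1..m j}"
    note x = lift_closed[OF w]
    have "?s (bincl j (lift j w)) = poly_of_const c \<odot>\<^bsub>V\<^esub> bincl j (lift j w)"
      using bincl_closed[OF x] by (simp add: scalar_endo_def)
    then have "(?s \<odot>\<^bsub>D j\<^esub> w) k = reduce E (poly_of_const c \<odot>\<^bsub>T j\<^esub> lift j w k)"
      by (simp add: D_smult_apply[OF s j w k] V_smult[OF j k] bincl_apply[OF j k])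
    also have "\<dots> = c \<otimes> reduce E (lift j w k)"
      by (simp only: reduce_smult[OF lam_pos[OF j] pc B_component[OF x k]] const_term_const[OF c])
    also have "reduce E (lift j w k) = w k" using rv_apply[OF k] rv_lift[OF j w] by metis
    finally show "(?s \<odot>\<^bsub>D j\<^esub> w) k = (c \<odot>\<^bsub>coord_space E (m j)\<^esub> w) k" using cs[OF k] by simp
  qed
qed

text \<open>The witness is the first standard basis vector. Together with
  \<open>D_munit_other\<close> it shows that \<open>e_i1\<close> detects exactly \<open>D_i\<close>
  among the \<open>D_j\<close>.\<close>

lemma D_munit_fixed_vector:
  assumes j: "j \<in> {1..r}"
  obtains d where "d \<in> carrier (D j)" "d \<noteq> \<zero>\<^bsub>D j\<^esub>" "munit j 1 1 \<odot>\<^bsub>D j\<^esub> d = d"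
proof
  note one = one_in_range[OF j]
  let ?d = "\<lambda>k\<in>{1..m j}. if k = 1 then \<one> else \<zero>"
  show d: "?d \<in> carrier (D j)" by (auto simp: D_carrier)
  have "?d 1 = \<one>" using one by simp
  then show "?d \<noteq> \<zero>\<^bsub>D j\<^esub>" using D_zero[OF one] one_not_zero by metis
  show "munit j 1 1 \<odot>\<^bsub>D j\<^esub> ?d = ?d"
    by (rule D_eqI[OF D_smult_closed[OF munit_closed[OF j one] j d] d])
      (use one in \<open>simp add: D_munit[OF j one j d]\<close>)
qed

lemma D_munit_other:
  assumes "i \<in> {1..r}" "j \<in> {1..r}" "i \<noteq> j" "w \<in> carrier (D j)"
  shows "munit i 1 1 \<odot>\<^bsub>D j\<^esub> w = \<zero>\<^bsub>D j\<^esub>"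
  by (rule D_eqI[OF D_smult_closed[OF munit_closed[OF assms(1) one_in_range[OF assms(1)]] assms(2,4)] D_zero_closed])
    (use assms in \<open>simp add: D_munit[OF assms(1) one_in_range[OF assms(1)] assms(2,4)] D_zero\<close>)

text \<open>The idempotent \<open>e_i1\<close> fixes a nonzero vector of \<open>D_i\<close> but
  annihilates \<open>D_j\<close> for \<open>j\<close> different from \<open>i\<close>, and
  isomorphisms respect this.\<close>

lemma D_iso_imp_eq:
  assumes i: "i \<in> {1..r}" and j: "j \<in> {1..r}" and iso: "mod_iso A (D i) (D j)"
  shows "i = j"
proof (rule ccontr)
  assume ij: "i \<noteq> j"
  obtain f where f: "f \<in> mod_homs A (D i) (D j)" and bij: "bij_betw f (carrier (D i)) (carrier (D j))"
    using iso unfolding mod_iso_def by blast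
  obtain d where d: "d \<in> carrier (D i)" "d \<noteq> \<zero>\<^bsub>D i\<^esub>" "munit i 1 1 \<odot>\<^bsub>D i\<^esub> d = d"
    using D_munit_fixed_vector[OF i] by metis
  have "f d = munit i 1 1 \<odot>\<^bsub>D j\<^esub> f d"
    using mod_homsD(4)[OF f munit_closed[OF i one_in_range[OF i]] d(1), of 1] d(3) by simp
  then have "f d = \<zero>\<^bsub>D j\<^esub>" using D_munit_other[OF i j ij mod_homsD(1)[OF f d(1)]] by simp
  then have "f d = f \<zero>\<^bsub>D i\<^esub>" using mod_homs_zero[OF D_left_module[OF i] D_left_module[OF j] f] by simp
  then show False using bij d D_zero_closed by (metis bij_betw_def inj_onD)
qed

text \<open>As the \<open>e_ik\<close> sum to \<open>\<one>\<close>, one of them acts nontrivially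
  on \<open>S\<close>; matrix units move it to \<open>k = 1\<close>, where \<open>S\<close> and
  \<open>D_i\<close> are compared through the same local idempotent.\<close>

lemma simple_complete:
  fixes S :: "(_, 's) module"
  assumes S: "simple_module A S"
  shows "\<exists>j\<in>{1..r}. mod_iso A S (D j)"
proof -
  interpret S: left_module A S using S by (simp add: simple_module_def)
  have "carrier S \<noteq> {\<zero>\<^bsub>S\<^esub>}" using S unfolding simple_module_def by blast
  then obtain s where s: "s \<in> carrier S" "s \<noteq> \<zero>\<^bsub>S\<^esub>" using S.zero_closed by blast
  have "\<exists>i k. i \<in> {1..r} \<and> k \<in> {1..m i} \<and> munit i k k \<odot>\<^bsub>S\<^esub> s \<noteq> \<zero>\<^bsub>S\<^esub>"
  proof (rule ccontr)
    assume no: "\<not> ?thesis"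
    have "\<one>\<^bsub>A\<^esub> \<odot>\<^bsub>S\<^esub> s = \<zero>\<^bsub>S\<^esub>"
    proof (induction rule: one_induct)
      case zero
      show ?case by (rule S.smult_l_null[OF s(1)])
    next
      case (add a b)
      then show ?case by (simp only: S.smult_l_distr[OF add(1,2) s(1)] S.l_zero[OF S.zero_closed])
    next
      case (unit i k)
      then show ?case using no by blast
    qed
    then show False using s S.smult_one[OF s(1)] by simp
  qed
  then obtain i k where i: "i \<in> {1..r}" and k: "k \<in> {1..m i}" and ne: "munit i k k \<odot>\<^bsub>S\<^esub> s \<noteq> \<zero>\<^bsub>S\<^esub>"
    by blast
  note one = one_in_range[OF i]
  note cl = munit_closed[OF i]
  \<comment> \<open>This vector is fixed by \<open>e_i1\<close>, and it is nonzero because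
    \<open>munit i k 1\<close> sends it to \<open>e_ik s\<close>.\<close>
  define t where "t = munit i 1 k \<odot>\<^bsub>S\<^esub> s"
  have t: "t \<in> carrier S" unfolding t_def by (rule S.smult_closed[OF cl[OF k] s(1)])
  have "munit i k 1 \<odot>\<^bsub>S\<^esub> t = munit i k k \<odot>\<^bsub>S\<^esub> s"
    unfolding t_def S.smult_assoc[OF cl[OF one] cl[OF k] s(1), symmetric] munit_mult[OF i k one k] ..
  then have "t \<noteq> \<zero>\<^bsub>S\<^esub>" using ne S.smult_r_null[OF cl[OF one]] by metis
  moreover have "munit i 1 1 \<odot>\<^bsub>S\<^esub> t = t"
    unfolding t_def S.smult_assoc[OF cl[OF one] cl[OF k] s(1), symmetric] munit_mult[OF i one one k] ..
  moreover obtain d where "d \<in> carrier (D i)" "d \<noteq> \<zero>\<^bsub>D i\<^esub>" "munit i 1 1 \<odot>\<^bsub>D i\<^esub> d = d"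
    using D_munit_fixed_vector[OF i] by metis
  ultimately have "mod_iso A S (D i)"
    using A.simple_modules_iso[OF S D_simple[OF i] munit_local_idem[OF i one] t] by blast
  then show ?thesis using i by blast
qed


subsection \<open>The principal indecomposable modules\<close>

lemma P_ideal_eq:
  assumes "i \<in> {1..r}"
  shows "P_ideal E r lam m i = left_ideal_gen A (munit i 1 1)"
  unfolding P_ideal_def left_ideal_gen_def munit_eq_e_elem[OF assms one_in_range[OF assms]] ..

text \<open>An isomorphism yields \<open>x = e_i1 x\<close> and \<open>y\<close> with
  \<open>y x = e_j1\<close>. If \<open>i\<close> and \<open>j\<close> differ, \<open>x\<close>
  annihilates \<open>D_j\<close> because \<open>e_i1\<close> does, yet \<open>e_j1\<close> fixes a
  nonzero vector there.\<close>

lemma P_iso_imp_eq: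
  assumes i: "i \<in> {1..r}" and j: "j \<in> {1..r}"
    and iso: "mod_iso A (regular_submodule A (P_ideal E r lam m i)) (regular_submodule A (P_ideal E r lam m j))"
  shows "i = j"
proof (rule ccontr)
  assume ij: "i \<noteq> j"
  note oi = one_in_range[OF i] and oj = one_in_range[OF j]
  note ei = munit_closed[OF i oi, of 1] and ej = munit_closed[OF j oj, of 1]
  interpret Dj: left_module A "D j" by (rule D_left_module[OF j])
  obtain x y where x: "x \<in> carrier A" "y \<in> carrier A" "munit i 1 1 \<otimes>\<^bsub>A\<^esub> x = x"
    "y \<otimes>\<^bsub>A\<^esub> x = munit j 1 1"
    using A.left_ideal_gen_isoD[OF ej munit_mult[OF j oj oj oj] ei munit_mult[OF i oi oi oi]]
      iso[unfolded P_ideal_eq[OF i] P_ideal_eq[OF j]] by metis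
  obtain d where d: "d \<in> carrier (D j)" "d \<noteq> \<zero>\<^bsub>D j\<^esub>" "munit j 1 1 \<odot>\<^bsub>D j\<^esub> d = d"
    using D_munit_fixed_vector[OF j] by metis
  have "x \<odot>\<^bsub>D j\<^esub> d = munit i 1 1 \<odot>\<^bsub>D j\<^esub> (x \<odot>\<^bsub>D j\<^esub> d)"
    using Dj.smult_assoc[OF ei x(1) d(1)] x(3) by simp
  also have "\<dots> = \<zero>\<^bsub>D j\<^esub>" by (rule D_munit_other[OF i j ij Dj.smult_closed[OF x(1) d(1)]])
  finally have "(y \<otimes>\<^bsub>A\<^esub> x) \<odot>\<^bsub>D j\<^esub> d = \<zero>\<^bsub>D j\<^esub>"
    using Dj.smult_assoc[OF x(2,1) d(1)] Dj.smult_r_null[OF x(2)] by simp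
  then show False using x(4) d by simp
qed

lemma P_complete:
  assumes "principal_indecomposable A Q"
  shows "\<exists>i\<in>{1..r}. mod_iso A (regular_submodule A Q) (regular_submodule A (P_ideal E r lam m i))"
proof -
  let ?J = "SIGMA i:{1..r}. {1..m i}" and ?e = "\<lambda>z. munit (fst z) (snd z) (snd z)"
  have "\<exists>i\<in>{1..r}. mod_iso A (regular_submodule A Q) (regular_submodule A (left_ideal_gen A (munit i 1 1)))"
  proof (rule A.principal_indecomposable_complete[where I = ?J and e = ?e, OF _ _ _ _ assms])
    show "finite ?J" by simp
    show "local_idem A (?e z)" if "z \<in> ?J" for z
      using that munit_local_idem by (cases z) simp
    show "\<one>\<^bsub>A\<^esub> \<in> L" if L: "submodule L A (regular_module A)" and e: "\<And>z. z \<in> ?J \<Longrightarrow> ?e z \<in> L" for L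
    proof (induction rule: one_induct)
      case zero
      show ?case using submoduleD(2)[OF L] by simp
    next
      case (add a b)
      then show ?case using submoduleD(3)[OF L] by simp
    next
      case (unit i k)
      then show ?case using e[of "(i, k)"] by simp
    qed
    show "\<exists>i\<in>{1..r}. \<exists>u\<in>carrier A. \<exists>v\<in>carrier A. munit i 1 1 \<in> carrier A \<and>
        munit i 1 1 \<otimes>\<^bsub>A\<^esub> munit i 1 1 = munit i 1 1 \<and> u \<otimes>\<^bsub>A\<^esub> v = ?e z \<and> v \<otimes>\<^bsub>A\<^esub> u = munit i 1 1"
      if z: "z \<in> ?J" for z
    proof -
      obtain i k where ik: "z = (i, k)" "i \<in> {1..r}" "k \<in> {1..m i}" using z by blast
      note one = one_in_range[OF ik(2)]
      \<comment> \<open>The equivalence of \<open>e_ik\<close> with \<open>e_i1\<close> is given by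
        \<open>munit i k 1\<close> and \<open>munit i 1 k\<close>, whose two products are these
        idempotents.\<close>
      show ?thesis
        by (rule bexI[OF _ ik(2)], rule bexI[of _ "munit i k 1"], rule bexI[of _ "munit i 1 k"])
          (use ik munit_closed[OF ik(2) one] munit_closed[OF ik(2,3)] munit_mult[OF ik(2) one one one]
            munit_mult[OF ik(2,3) one ik(3)] munit_mult[OF ik(2) one ik(3) one] in simp_all)
    qed
  qed
  then show ?thesis using P_ideal_eq by metis
qed

end


text \<open>The number of classes is expressed by non-isomorphism for distinct indices together with
  completeness, where \<open>S\<close> may live on an arbitrary carrier type \<open>'s\<close>. The
  \<open>scalar_endo\<close> clause identifies the vector space structure that \<open>D_j\<close>
  inherits from the algebra.\<close>

theorem mainTheorem4:
  fixes K :: "('k, 'x) ring_scheme"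
    and p :: "'k list"
    and E :: "'k list set ring"
    and r :: nat
    and lam m :: "nat \<Rightarrow> nat"
    and A :: "((nat \<Rightarrow> nat \<Rightarrow> 'k list set list set) \<Rightarrow> (nat \<Rightarrow> nat \<Rightarrow> 'k list set list set)) ring"
  assumes K: "perfect_field K"
    and p: "p \<in> carrier (poly_ring K)" "pirreducible\<^bsub>K\<^esub> (carrier K) p"
    and E: "E = Rupt\<^bsub>K\<^esub> (carrier K) p"
    and lam: "strict_mono_on {1..r} lam" "\<And>i. i \<in> {1..r} \<Longrightarrow> 0 < lam i"
    and m: "\<And>i. i \<in> {1..r} \<Longrightarrow> 0 < m i"
    and A: "A = M_lam E r lam m"
  shows
    "((\<forall>j\<in>{1..r}. simple_module A (D_module E r lam m j)) \<and>
      (\<forall>j\<in>{1..r}. \<forall>c\<in>carrier E. \<forall>v\<in>carrier (D_module E r lam m j).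
         scalar_endo E r lam m c \<in> carrier A \<and>
         scalar_endo E r lam m c \<odot>\<^bsub>D_module E r lam m j\<^esub> v = c \<odot>\<^bsub>coord_space E (m j)\<^esub> v) \<and>
      (\<forall>i\<in>{1..r}. \<forall>j\<in>{1..r}.
         mod_iso A (D_module E r lam m i) (D_module E r lam m j) \<longrightarrow> i = j) \<and>
      (\<forall>S :: ((nat \<Rightarrow> nat \<Rightarrow> 'k list set list set) \<Rightarrow> (nat \<Rightarrow> nat \<Rightarrow> 'k list set list set), 's) module.
         simple_module A S \<longrightarrow> (\<exists>j\<in>{1..r}. mod_iso A S (D_module E r lam m j))))
     \<and>
     ((\<forall>i\<in>{1..r}. principal_indecomposable A (P_ideal E r lam m i)) \<and>
      (\<forall>i\<in>{1..r}. \<forall>j\<in>{1..r}.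
         mod_iso A (regular_submodule A (P_ideal E r lam m i))
           (regular_submodule A (P_ideal E r lam m j)) \<longrightarrow> i = j) \<and>
      (\<forall>Q. principal_indecomposable A Q \<longrightarrow>
         (\<exists>i\<in>{1..r}. mod_iso A (regular_submodule A Q)
            (regular_submodule A (P_ideal E r lam m i)))))"
proof -
  interpret K: field K using K unfolding perfect_field_def by (rule conjunct1)
  \<comment> \<open>The quotient of \<open>K[t]\<close> by \<open>p\<close> is a field exactly when
    \<open>p\<close> is irreducible.\<close>
  have "field (Rupt\<^bsub>K\<^esub> (carrier K) p)"
    by (rule iffD2[OF K.rupture_is_field_iff_pirreducible[OF K.carrier_is_subfield p(1)] p(2)])
  then have field_E: "field E" by (simp only: E)
  interpret M: partition_module E r lam m
    by (intro partition_module.intro partition_module_axioms.intro poly_field.intro field_E lam m)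
  have P: "principal_indecomposable M.A (P_ideal E r lam m i)" if "i \<in> {1..r}" for i
    unfolding M.P_ideal_eq[OF that]
    by (rule M.A.local_idem_principal_indecomposable[OF M.munit_local_idem[OF that M.one_in_range[OF that]]])
  show ?thesis
    unfolding A
    by (intro conjI ballI allI impI;
        (rule M.D_simple M.scalar_action M.D_iso_imp_eq M.simple_complete P M.P_iso_imp_eq M.P_complete;
          assumption))
qed

end
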